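(* Let $X,Y_1,\dots,Y_n$ be real separable Hilbert spaces, $Y=\prod_{i=1}^n Y_i$, let $A_i:X\to Y_i$ be bounded linear operators, and let $g:X\to\mathbb{R}\cup\{\infty\}$, $f_i:Y_i\to\mathbb{R}\cup\{\infty\}$ ($i=1,\dots,n$) be convex, proper and lower-semicontinuous. Let $\tau,\sigma_1,\dots,\sigma_n>0$. Assume that the set of saddle points of $$\min_{x\in X}\max_{y\in Y} L(x,y),\qquad L(x,y)=\sum_{i=1}^n\{\langle A_ix,y_i\rangle-f_i^*(y_i)\}+g(x),$$ is nonempty, and that the proximity operators $\mathrm{prox}_{\tau g}$ and $\mathrm{prox}_{\sigma_i f_i^*}$ ($i=1,\dots,n$) are weakly sequentially continuous. Let $(\mathbb{S}^k)_{k\ge 0}$ be independent, identically distributed random subsets of $\{1,\dots,n\}$ forming a proper sampling, let $D$ be the associated step size operator, and assume $\|D\|<1$. Let $\theta=1$. Then, for any starting points $x^0\in X$, $y^0\in Y$, the random sequence $(x^k,y^k)_{k\in\mathbb{N}}$ generated by the SPDHG algorithm converges weakly almost surely to a saddle point.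
   Context: Convex conjugate: $f_i^*(y)=\sup_{u\in Y_i}\{\langle u,y\rangle-f_i(u)\}$. Saddle point: a point $(\hat x,\hat y)\in X\times Y$ solving the min-max problem, i.e. with $g(\hat x)<\infty$, $f_i^*(\hat y_i)<\infty$ for all $i$, and $L(\hat x,y)\le L(\hat x,\hat y)\le L(x,\hat y)$ for all $x$ with $g(x)<\infty$ and all $y$ with $f_i^*(y_i)<\infty$ for all $i$. Proximity operator: $\mathrm{prox}_h(v)=\arg\min_u\{\tfrac12\|v-u\|^2+h(u)\}$. A map $T$ is weakly sequentially continuous if $v^k\rightharpoonup v$ implies $T(v^k)\rightharpoonup T(v)$ for every weakly convergent sequence. Sampling: $\mathbb{S}^k$, $k\ge0$, are i.i.d. random subsets of $\{1,\dots,n\}$, with common distribution that of a random subset $\mathbb{S}$. The sampling is proper if $p_i:=\mathbb{P}(i\in\mathbb{S}^k)>0$ for every $i\in\{1,\dots,n\}$. SPDHG algorithm: given (deterministic) $x^0\in X$, $y^0\in Y$, set $z^0=\bar z^0=A^*y^0$, where $A^*y=\sum_{i=1}^nA_i^*y_i$. For $k\ge0$: draw $\mathbb{S}^k$; set $x^{k+1}=\mathrm{prox}_{\tau g}(x^k-\tau\bar z^k)$; set $y_i^{k+1}=\mathrm{prox}_{\sigma_if_i^*}(y_i^k+\sigma_iA_ix^{k+1})$ if $i\in\mathbb{S}^k$ and $y_i^{k+1}=y_i^k$ otherwise; set $\delta_i=A_i^*(y_i^{k+1}-y_i^k)$ for $i\in\mathbb{S}^k$; set $z^{k+1}=z^k+\sum_{i\in\mathbb{S}^k}\delta_i$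 and $\bar z^{k+1}=z^{k+1}+\theta\sum_{i\in\mathbb{S}^k}p_i^{-1}\delta_i$. Step size operator: let $C_i=\tau^{1/2}\sigma_i^{1/2}A_i$; for $\mathcal{S}\subset\{1,\dots,n\}$ let $C_{\mathcal{S}}:X\to Y$ be $(C_{\mathcal{S}}x)_i=C_ix$ if $i\in\mathcal{S}$ and $0$ otherwise, with adjoint $C_{\mathcal{S}}^*y=\sum_{i\in\mathcal{S}}C_i^*y_i$; let $Q:Y\to Y$ be $(Qy)_i=p_i^{-1}y_i$. Then $D:=Q\,\mathbb{E}(C_{\mathbb{S}}C_{\mathbb{S}}^* )\,Q:Y\to Y$, and $\|D\|$ is its operator norm. Weak almost sure convergence of a random sequence $(w^k)$ to $\hat w$ (which may be random): there is an event $\Omega$ with $\mathbb{P}(\Omega)=1$ such that $w^k(\omega)\rightharpoonup\hat w(\omega)$ weakly for every $\omega\in\Omega$; convergence to a saddle point means $\hat w(\omega)$ is a saddle point for every $\omega \in\Omega$. *)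

theory Defs
  imports "HOL-Probability.Probability"
begin

text \<open>
  The factors of the product \<open>Y\<close> may be different Hilbert spaces. They are modelled as closed
  linear subspaces \<open>Y i\<close> of one ambient separable Hilbert space \<^typ>\<open>'b\<close>, for \<open>i\<close> in a finite type
  \<^typ>\<open>'n\<close> (up to isometry every finite family of separable Hilbert spaces arises in this way, for instance
  inside its direct sum). Elements of the product are vectors of type \<^typ>\<open>'b ^ 'n\<close>, whose library
  inner product is the sum of the componentwise ones. Functions on \<open>Y i\<close> are total functions on
  \<^typ>\<open>'b\<close> of which only the values on \<open>Y i\<close> are used. A Hilbert space is separable iff its topology
  has a countable base, hence the sort constraints.
\<close>

instance vec :: ("{metric_space, second_countable_topology}", finite) second_countable_topology
proof
  obtain B :: "'a set set" where B: "countable B" "open = generate_topology B"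
    using ex_countable_subbasis by blast
  define S :: "('a ^ 'b) set set" where "S = (\<lambda>(i, U). (\<lambda>x. x $ i) -` U) ` (UNIV \<times> B)"
  have "countable S"
    unfolding S_def using B(1) by (intro countable_image countable_SIGMA) auto
  moreover have "open = generate_topology S"
  proof (intro ext iffI)
    fix X :: "('a ^ 'b) set"
    assume "generate_topology S X"
    then show "open X"
    proof induction
      case (Basis s)
      then obtain i U where s: "s = (\<lambda>x. x $ i) -` U" "U \<in> B"
        by (auto simp: S_def)
      then have "open U"
        using B(2) generate_topology.Basis by metis
      then show ?case
        unfolding s(1) by (rule open_vimage_vec_nth)
    qed auto
  next
    fix X :: "('a ^ 'b) set"
    assume X: "open X"
    have comp: "generate_topology S ((\<lambda>x. x $ i) -` U)" if "open U" for i U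
    proof -
      have "generate_topology B U"
        using that B(2) by metis
      then show ?thesis
      proof induction
        case UNIV
        then show ?case by (auto intro: generate_topology.UNIV)
      next
        case (Int a b)
        then show ?case by (auto simp: vimage_Int intro: generate_topology.Int)
      next
        case (UN K)
        have "generate_topology S (\<Union>k\<in>K. (\<lambda>x. x $ i) -` k)"
          using UN by (intro generate_topology.UN) auto
        moreover have "(\<lambda>x. x $ i) -` \<Union>K = (\<Union>k\<in>K. (\<lambda>x. x $ i) -` k)"
          by auto
        ultimately show ?case by simp
      next
        case (Basis s)
        then show ?case
          by (intro generate_topology.Basis) (auto simp: S_def)
      qed
    qed
    have fin: "generate_topology S (\<Inter>i\<in>I. (\<lambda>x. x $ i) -` A i)"
      if "finite I" "\<And>i. open (A i)" for I :: "'b set" and A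
      using that(1)
    proof induction
      case empty
      then show ?case by (auto intro: generate_topology.UNIV)
    next
      case (insert i I)
      then show ?case using comp[OF that(2)] by (auto intro: generate_topology.Int)
    qed
    define \<U> where "\<U> = {U. generate_topology S U \<and> U \<subseteq> X}"
    have "X = \<Union>\<U>"
    proof (intro equalityI subsetI)
      fix x assume "x \<in> X"
      with X obtain A where A: "\<And>i. open (A i)" "\<And>i. x $ i \<in> A i"
        and sub: "\<And>y. (\<forall>i. y $ i \<in> A i) \<Longrightarrow> y \<in> X"
        unfolding open_vec_def by metis
      let ?U = "\<Inter>i\<in>UNIV. (\<lambda>x. x $ i) -` A i"
      have "?U \<in> \<U>" "x \<in> ?U"
        using fin[OF finite A(1)] A(2) sub by (auto simp: \<U>_def)
      then show "x \<in> \<Union>\<U>" by blast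
    qed (auto simp: \<U>_def)
    moreover have "generate_topology S (\<Union>\<U>)"
      by (intro generate_topology.UN) (auto simp: \<U>_def)
    ultimately show "generate_topology S X" by simp
  qed
  ultimately show "\<exists>S::('a ^ 'b) set set. countable S \<and> open = generate_topology S"
    by blast
qed

definition prod_space :: "('n \<Rightarrow> 'b set) \<Rightarrow> ('b ^ 'n) set" where
  "prod_space Y = {y. \<forall>i. y $ i \<in> Y i}"

text \<open>
  Weak convergence inside a closed subspace \<open>H\<close> of a Hilbert space; by the Riesz representation
  theorem the continuous linear functionals on \<open>H\<close> are the maps \<open>v \<mapsto> v \<bullet> h\<close> with \<open>h \<in> H\<close>.
\<close>

definition weakly_conv_on :: "'a::real_inner set \<Rightarrow> (nat \<Rightarrow> 'a) \<Rightarrow> 'a \<Rightarrow> bool" where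
  "weakly_conv_on H v w \<longleftrightarrow>
     (\<forall>k. v k \<in> H) \<and> w \<in> H \<and> (\<forall>h\<in>H. (\<lambda>k. v k \<bullet> h) \<longlonglongrightarrow> w \<bullet> h)"

definition weakly_seq_continuous_on :: "'a::real_inner set \<Rightarrow> ('a \<Rightarrow> 'a) \<Rightarrow> bool" where
  "weakly_seq_continuous_on H T \<longleftrightarrow>
     (\<forall>v w. weakly_conv_on H v w \<longrightarrow> weakly_conv_on H (\<lambda>k. T (v k)) (T w))"

text \<open>Functions with values in \<open>\<real> \<union> {\<infinity>}\<close> are \<^typ>\<open>ereal\<close>-valued functions avoiding \<open>-\<infinity>\<close>.\<close>

definition proper_fun_on :: "'a set \<Rightarrow> ('a \<Rightarrow> ereal) \<Rightarrow> bool" where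
  "proper_fun_on H h \<longleftrightarrow> (\<forall>u\<in>H. h u \<noteq> -\<infinity>) \<and> (\<exists>u\<in>H. h u < \<infinity>)"

definition convex_fun_on :: "'a::real_vector set \<Rightarrow> ('a \<Rightarrow> ereal) \<Rightarrow> bool" where
  "convex_fun_on H h \<longleftrightarrow>
     (\<forall>u\<in>H. \<forall>v\<in>H. \<forall>t. 0 < t \<and> t < 1 \<longrightarrow>
        h ((1 - t) *\<^sub>R u + t *\<^sub>R v) \<le> ereal (1 - t) * h u + ereal t * h v)"

definition lsc_fun_on :: "'a::topological_space set \<Rightarrow> ('a \<Rightarrow> ereal) \<Rightarrow> bool" where
  "lsc_fun_on H h \<longleftrightarrow> (\<forall>u\<in>H. h u \<le> Liminf (at u within H) h)"

definition conjugate :: "'a::real_inner set \<Rightarrow> ('a \<Rightarrow> ereal) \<Rightarrow> 'a \<Rightarrow> ereal" where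
  "conjugate H h y = (SUP u\<in>H. ereal (u \<bullet> y) - h u)"

definition prox :: "'a::real_inner set \<Rightarrow> ('a \<Rightarrow> ereal) \<Rightarrow> 'a \<Rightarrow> 'a" where
  "prox H h v = arg_min_on (\<lambda>u. ereal (1 / 2 * (norm (v - u))\<^sup>2) + h u) H"

definition lagrangian ::
  "('n::finite \<Rightarrow> 'b::real_inner set) \<Rightarrow> ('n \<Rightarrow> 'x \<Rightarrow> 'b) \<Rightarrow> ('x \<Rightarrow> ereal) \<Rightarrow> ('n \<Rightarrow> 'b \<Rightarrow> ereal)
     \<Rightarrow> 'x \<Rightarrow> 'b ^ 'n \<Rightarrow> ereal" where
  "lagrangian Y A g f x y =
     (\<Sum>i\<in>UNIV. ereal (A i x \<bullet> y $ i) - conjugate (Y i) (f i) (y $ i)) + g x"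

definition saddle_point ::
  "('n::finite \<Rightarrow> 'b::real_inner set) \<Rightarrow> ('n \<Rightarrow> 'x \<Rightarrow> 'b) \<Rightarrow> ('x \<Rightarrow> ereal) \<Rightarrow> ('n \<Rightarrow> 'b \<Rightarrow> ereal)
     \<Rightarrow> 'x \<times> ('b ^ 'n) \<Rightarrow> bool" where
  "saddle_point Y A g f = (\<lambda>(x', y').
     y' \<in> prod_space Y \<and> g x' < \<infinity> \<and> (\<forall>i. conjugate (Y i) (f i) (y' $ i) < \<infinity>) \<and>
     (\<forall>y\<in>prod_space Y. (\<forall>i. conjugate (Y i) (f i) (y $ i) < \<infinity>) \<longrightarrow>
        lagrangian Y A g f x' y \<le> lagrangian Y A g f x' y') \<and>
     (\<forall>x. g x < \<infinity> \<longrightarrow> lagrangian Y A g f x' y' \<le> lagrangian Y A g f x y'))"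

definition inclusion_prob :: "'w measure \<Rightarrow> ('w \<Rightarrow> 'n set) \<Rightarrow> 'n \<Rightarrow> real" where
  "inclusion_prob M R i = measure M {\<omega> \<in> space M. i \<in> R \<omega>}"

definition C_op ::
  "('n \<Rightarrow> 'x::real_inner \<Rightarrow> 'b::real_inner) \<Rightarrow> real \<Rightarrow> ('n \<Rightarrow> real) \<Rightarrow> 'n \<Rightarrow> 'x \<Rightarrow> 'b" where
  "C_op A \<tau> \<sigma> i x = (sqrt \<tau> * sqrt (\<sigma> i)) *\<^sub>R A i x"

definition C_set ::
  "('n::finite \<Rightarrow> 'x::real_inner \<Rightarrow> 'b::real_inner) \<Rightarrow> real \<Rightarrow> ('n \<Rightarrow> real) \<Rightarrow> 'n set \<Rightarrow> 'x \<Rightarrow> 'b ^ 'n" where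
  "C_set A \<tau> \<sigma> s x = (\<chi> i. if i \<in> s then C_op A \<tau> \<sigma> i x else 0)"

text \<open>
  The theorem assumes that \<open>A i\<close> maps into \<open>Y i\<close>, so that the library adjoint of \<open>A i\<close> as a map into the ambient space
  agrees on \<open>Y i\<close> with the adjoint of \<open>A i\<close> as a map into \<open>Y i\<close>.
\<close>

definition C_set_adj ::
  "('n::finite \<Rightarrow> 'x::real_inner \<Rightarrow> 'b::real_inner) \<Rightarrow> real \<Rightarrow> ('n \<Rightarrow> real) \<Rightarrow> 'n set \<Rightarrow> 'b ^ 'n \<Rightarrow> 'x" where
  "C_set_adj A \<tau> \<sigma> s y = (\<Sum>i\<in>s. adjoint (C_op A \<tau> \<sigma> i) (y $ i))"

definition Q_op :: "('n::finite \<Rightarrow> real) \<Rightarrow> ('b::real_vector) ^ 'n \<Rightarrow> 'b ^ 'n" where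
  "Q_op p y = (\<chi> i. inverse (p i) *\<^sub>R y $ i)"

text \<open>
  The sampling takes finitely many values, so the expectation of the random operator can be taken
  pointwise.
\<close>

definition step_op ::
  "'w measure \<Rightarrow> ('w \<Rightarrow> 'n set)
     \<Rightarrow> ('n::finite \<Rightarrow> 'x::real_inner \<Rightarrow> 'b::{real_inner, complete_space, second_countable_topology})
     \<Rightarrow> real \<Rightarrow> ('n \<Rightarrow> real) \<Rightarrow> 'b ^ 'n \<Rightarrow> 'b ^ 'n" where
  "step_op M R A \<tau> \<sigma> y =
     (let Q = Q_op (inclusion_prob M R)
      in Q (LINT \<omega>|M. C_set A \<tau> \<sigma> (R \<omega>) (C_set_adj A \<tau> \<sigma> (R \<omega>) (Q y))))"

text \<open>The operator norm on a subspace \<open>H\<close>; for \<open>H = UNIV\<close> this is the library's \<^const>\<open>onorm\<close>.\<close>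

definition onorm_on :: "'a::real_normed_vector set \<Rightarrow> ('a \<Rightarrow> 'c::real_normed_vector) \<Rightarrow> real" where
  "onorm_on H T = (SUP u\<in>H. norm (T u) / norm u)"

text \<open>
  The iterates \<open>(x\<^sup>k, y\<^sup>k, z\<^sup>k, zbar\<^sup>k)\<close> for a fixed realisation \<open>s 0, s 1, \<dots>\<close> of the sampling;
  \<open>p\<close> is the vector of inclusion probabilities.
\<close>

primrec spdhg ::
  "('n::finite \<Rightarrow> 'b::real_inner set) \<Rightarrow> ('n \<Rightarrow> 'x::real_inner \<Rightarrow> 'b) \<Rightarrow> ('x \<Rightarrow> ereal)
     \<Rightarrow> ('n \<Rightarrow> 'b \<Rightarrow> ereal) \<Rightarrow> real \<Rightarrow> ('n \<Rightarrow> real) \<Rightarrow> real \<Rightarrow> ('n \<Rightarrow> real) \<Rightarrow> 'x \<Rightarrow> 'b ^ 'n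
     \<Rightarrow> (nat \<Rightarrow> 'n set) \<Rightarrow> nat \<Rightarrow> 'x \<times> ('b ^ 'n) \<times> 'x \<times> 'x" where
  "spdhg Y A g f \<tau> \<sigma> \<theta> p x0 y0 s 0 =
     (let z0 = (\<Sum>i\<in>UNIV. adjoint (A i) (y0 $ i)) in (x0, y0, z0, z0))"
| "spdhg Y A g f \<tau> \<sigma> \<theta> p x0 y0 s (Suc k) =
     (let (x, y, z, zbar) = spdhg Y A g f \<tau> \<sigma> \<theta> p x0 y0 s k;
          x' = prox UNIV (\<lambda>u. ereal \<tau> * g u) (x - \<tau> *\<^sub>R zbar);
          y' = (\<chi> i. if i \<in> s k
                     then prox (Y i) (\<lambda>u. ereal (\<sigma> i) * conjugate (Y i) (f i) u)
                            (y $ i + \<sigma> i *\<^sub>R A i x')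
                     else y $ i);
          \<delta> = (\<lambda>i. adjoint (A i) (y' $ i - y $ i));
          z' = z + (\<Sum>i\<in>s k. \<delta> i);
          zbar' = z' + \<theta> *\<^sub>R (\<Sum>i\<in>s k. inverse (p i) *\<^sub>R \<delta> i)
      in (x', y', z', zbar'))"

definition spdhg_xy ::
  "('n::finite \<Rightarrow> 'b::real_inner set) \<Rightarrow> ('n \<Rightarrow> 'x::real_inner \<Rightarrow> 'b) \<Rightarrow> ('x \<Rightarrow> ereal)
     \<Rightarrow> ('n \<Rightarrow> 'b \<Rightarrow> ereal) \<Rightarrow> real \<Rightarrow> ('n \<Rightarrow> real) \<Rightarrow> real \<Rightarrow> ('n \<Rightarrow> real) \<Rightarrow> 'x \<Rightarrow> 'b ^ 'n
     \<Rightarrow> (nat \<Rightarrow> 'n set) \<Rightarrow> nat \<Rightarrow> 'x \<times> ('b ^ 'n)" where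
  "spdhg_xy Y A g f \<tau> \<sigma> \<theta> p x0 y0 s k =
     (let (x, y, z, zbar) = spdhg Y A g f \<tau> \<sigma> \<theta> p x0 y0 s k in (x, y))"

text \<open>
  Weak almost sure convergence, in a closed subspace \<open>H\<close>, of a random sequence to a random limit
  whose values on an almost sure event satisfy \<open>P\<close>.
\<close>

definition weakly_conv_as_to ::
  "'w measure \<Rightarrow> 'a::real_inner set \<Rightarrow> (nat \<Rightarrow> 'w \<Rightarrow> 'a) \<Rightarrow> ('a \<Rightarrow> bool) \<Rightarrow> bool" where
  "weakly_conv_as_to M H W P \<longleftrightarrow>
     (\<exists>w \<in> borel_measurable M. \<exists>\<Omega> \<in> sets M. measure M \<Omega> = 1 \<and>
        (\<forall>\<omega>\<in>\<Omega>. P (w \<omega>) \<and> weakly_conv_on H (\<lambda>k. W k \<omega>) (w \<omega>)))"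

end

theory Submission
  imports Defs
begin

text \<open>
  Fix a saddle point \<open>(x\<^sup>*, y\<^sup>*)\<close> and put \<open>m\<^sup>k = zbar\<^sup>k - z\<^sup>k\<close> and \<open>\<gamma> = (1 + \<parallel>D\<parallel>) / 2 < 1\<close>. The proof rests on
  the Lyapunov function
  \<open>U = \<parallel>x - x\<^sup>*\<parallel>\<^sup>2 / (2 \<tau>) + \<Sum>\<^sub>i \<parallel>y\<^sub>i - y\<^sub>i\<^sup>*\<parallel>\<^sup>2 / (2 \<sigma>\<^sub>i p\<^sub>i) - \<langle>m, x - x\<^sup>*\<rangle> + \<tau> / (2 \<gamma>) \<parallel>m\<parallel>\<^sup>2\<close>.
  The weights \<open>1 / p\<^sub>i\<close> make the mean over the next sample of the dual distance change as if all blocks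
  had been updated. The mixed term telescopes, because the mean of \<open>m\<^sup>k\<^sup>+\<^sup>1\<close> is the change of
  \<open>A\<^sup>* y\<close> under the full update. The last term completes the square, so that \<open>U \<ge> 0\<close>, and it is affordable because
  \<open>\<parallel>D\<parallel> \<le> \<gamma>\<^sup>2\<close> bounds the mean of \<open>\<tau> \<parallel>m\<^sup>k\<^sup>+\<^sup>1\<parallel>\<^sup>2\<close> by \<open>\<gamma>\<^sup>2\<close> times the squared length of the
  full dual step, with weights \<open>1 / \<sigma>\<^sub>i\<close>. Thus the mean
  of \<open>U\<close> after one step is at most \<open>U\<close> minus \<open>1 - \<gamma>\<close> times the sum of the squared lengths of
  the primal step, over \<open>2 \<tau>\<close>, and of the full dual steps, over \<open>2 \<sigma>\<^sub>i\<close> (\<open>lyapunov_step\<close>).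

  The iterates \<open>(x, y, z, zbar)\<close> arise by applying random maps driven by i.i.d. samples from a finite
  set, so \<open>U\<close> is a nonnegative supermartingale along them. Almost surely the decreases are summable
  (\<open>lyapunov_summable\<close>), and \<open>U\<close> converges (\<open>lyapunov_convergent\<close>). For the latter, Doob's upcrossing
  argument is turned into a Lyapunov function for the state augmented by two flags.

  What remains concerns a single realisation. The steps and \<open>m\<^sup>k\<close> tend to \<open>0\<close>, so by the weak sequential
  continuity of the proximal maps every weak cluster point is a fixed point of the full step, that is,
  a saddle point (\<open>weak_cluster_point_saddle\<close>). The weighted distance to each saddle point of a
  countable dense set converges, because \<open>U\<close> does, and Opial's lemma (\<open>opial_weakly_convergent\<close>) gives
  weak convergence. Countability is what makes one event of probability one serve all these saddle
  points. The limit is a random variable by Pettis' theorem (\<open>borel_measurable_if_inner_measurable\<close>).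

  The proximal maps are handled through one existence lemma for minimisers of \<open>\<parallel>v - u\<parallel>\<^sup>2 / 2 + h u\<close>. It
  also yields the Riesz representation theorem, on which adjoints and weak compactness depend.
\<close>

section \<open>Proximal maps, Riesz representation and adjoints\<close>

lemma proper_fun_on_real:
  assumes "proper_fun_on H h" "u \<in> H" "h u < \<infinity>"
  shows "\<exists>r. h u = ereal r"
  using assms by (cases "h u") (auto simp: proper_fun_on_def)

lemma convex_fun_on_real:
  assumes "convex_fun_on H h" "proper_fun_on H h" "subspace H"
    and u: "u \<in> H" "h u < \<infinity>" and v: "v \<in> H" "h v < \<infinity>" and t: "0 < t" "t < 1"
  shows "(1 - t) *\<^sub>R u + t *\<^sub>R v \<in> H" "h ((1 - t) *\<^sub>R u + t *\<^sub>R v) < \<infinity>"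
    and "real_of_ereal (h ((1 - t) *\<^sub>R u + t *\<^sub>R v))
           \<le> (1 - t) * real_of_ereal (h u) + t * real_of_ereal (h v)"
proof -
  let ?w = "(1 - t) *\<^sub>R u + t *\<^sub>R v"
  show wH: "?w \<in> H"
    using assms by (intro subspace_add subspace_scale) auto
  have "h ?w \<le> ereal (1 - t) * h u + ereal t * h v"
    using assms by (auto simp: convex_fun_on_def)
  also have "\<dots> = ereal ((1 - t) * real_of_ereal (h u) + t * real_of_ereal (h v))"
  proof -
    obtain a b where "h u = ereal a" "h v = ereal b"
      using proper_fun_on_real[OF assms(2) u] proper_fun_on_real[OF assms(2) v] by blast
    then show ?thesis by simp
  qed
  finally have le: "h ?w \<le> ereal ((1 - t) * real_of_ereal (h u) + t * real_of_ereal (h v))" .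
  then show fin: "h ?w < \<infinity>"
    by (rule le_less_trans) simp
  show "real_of_ereal (h ?w) \<le> (1 - t) * real_of_ereal (h u) + t * real_of_ereal (h v)"
  proof -
    obtain r where "h ?w = ereal r"
      using proper_fun_on_real[OF assms(2) wH fin] by blast
    then show ?thesis using le by simp
  qed
qed

text \<open>
  The case \<open>u k = q\<close> is treated separately because the limit inferior in the definition of lower
  semicontinuity is taken over punctured neighbourhoods.
\<close>

lemma lsc_fun_on_le_limit:
  fixes h :: "'a::metric_space \<Rightarrow> ereal"
  assumes "lsc_fun_on H h" "\<And>k::nat. u k \<in> H" "u \<longlonglongrightarrow> q" "q \<in> H"
    and le: "\<And>k. h (u k) \<le> c k" and c: "c \<longlonglongrightarrow> (C::ereal)"
  shows "h q \<le> C"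
proof (rule ccontr)
  assume "\<not> h q \<le> C"
  then obtain d where d: "C < d" "d < h q"
    using dense[of C "h q"] by (auto simp: not_le)
  then have "d < Liminf (at q within H) h"
    using assms(1,4) by (auto simp: lsc_fun_on_def intro: less_le_trans)
  then have "\<forall>\<^sub>F w in at q within H. d < h w"
    by (rule less_LiminfD)
  then obtain e where e: "e > 0" "\<And>w. w \<in> H \<Longrightarrow> w \<noteq> q \<Longrightarrow> dist w q < e \<Longrightarrow> d < h w"
    unfolding eventually_at by auto
  have "\<forall>\<^sub>F k in sequentially. dist (u k) q < e"
    using assms(3) e(1) by (rule tendstoD)
  moreover have "\<forall>\<^sub>F k in sequentially. c k < d"
    using c d(1) by (rule order_tendstoD)
  ultimately have "\<forall>\<^sub>F k in sequentially. False"
  proof eventually_elim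
    case (elim k)
    have "d < h (u k)"
      using e(2)[of "u k"] elim(1) assms(2) d(2) by (cases "u k = q") auto
    with elim(2) le[of k] show False by auto
  qed
  then show False by simp
qed

text \<open>
  Minimising sequences of \<open>u \<mapsto> \<parallel>v - u\<parallel>\<^sup>2 / 2 + h u\<close> are Cauchy: the parallelogram law makes
  the objective at the midpoint of two almost minimal points smaller than the infimum unless the two
  points are close. Lower semicontinuity then makes the limit a minimiser.
\<close>

lemma prox_objective_attains_min:
  fixes H :: "'a::{real_inner, complete_space} set"
  assumes H: "subspace H" "closed H"
    and h: "convex_fun_on H h" "proper_fun_on H h" "lsc_fun_on H h"
    and bdd: "\<And>u. u \<in> H \<Longrightarrow> h u < \<infinity> \<Longrightarrow> m \<le> 1/2 * (norm (v - u))\<^sup>2 + real_of_ereal (h u)"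
  shows "\<exists>q\<in>H. h q < \<infinity> \<and> (\<forall>u\<in>H. h u < \<infinity> \<longrightarrow>
           1/2 * (norm (v - q))\<^sup>2 + real_of_ereal (h q) \<le> 1/2 * (norm (v - u))\<^sup>2 + real_of_ereal (h u))"
proof -
  define D where "D = {u\<in>H. h u < \<infinity>}"
  define \<phi> where "\<phi> u = 1/2 * (norm (v - u))\<^sup>2 + real_of_ereal (h u)" for u
  define I where "I = (INF u\<in>D. \<phi> u)"
  have ne: "D \<noteq> {}"
    using h(2) by (auto simp: D_def proper_fun_on_def)
  have bb: "bdd_below (\<phi> ` D)"
    using bdd by (intro bdd_belowI2[of _ m]) (auto simp: D_def \<phi>_def)
  have I_le: "I \<le> \<phi> u" if "u \<in> D" for u
    unfolding I_def using bb that by (rule cINF_lower)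
  have "\<exists>u\<in>D. \<phi> u < I + 1 / real (Suc k)" for k
    using cINF_less_iff[OF ne bb, of "I + 1 / real (Suc k)"] by (simp add: I_def)
  then obtain u where u: "\<And>k. u k \<in> D" "\<And>k. \<phi> (u k) < I + 1 / real (Suc k)"
    by metis
  have key: "(norm (a - b))\<^sup>2 \<le> 4 * ((\<phi> a - I) + (\<phi> b - I))" if "a \<in> D" "b \<in> D" for a b
  proof -
    let ?w = "(1 - 1/2) *\<^sub>R a + (1/2) *\<^sub>R b"
    have w: "?w \<in> D" "real_of_ereal (h ?w) \<le> 1/2 * real_of_ereal (h a) + 1/2 * real_of_ereal (h b)"
      using convex_fun_on_real[OF h(1,2) H(1), of a b "1/2"] that by (auto simp: D_def)
    have "v - ?w = (1/2) *\<^sub>R ((v - a) + (v - b))"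
      by (simp add: algebra_simps flip: scaleR_2)
    moreover have "a - b = (v - b) - (v - a)" by simp
    ultimately have "(norm (v - ?w))\<^sup>2 = 1/2 * (norm (v - a))\<^sup>2 + 1/2 * (norm (v - b))\<^sup>2 - 1/4 * (norm (a - b))\<^sup>2"
      unfolding power2_norm_eq_inner
      by (simp only:) (simp add: inner_add_left inner_add_right inner_diff_left inner_diff_right inner_commute field_simps)
    then have "\<phi> ?w \<le> 1/2 * \<phi> a + 1/2 * \<phi> b - 1/8 * (norm (a - b))\<^sup>2"
      using w(2) by (simp add: \<phi>_def field_simps)
    with I_le[OF w(1)] show ?thesis by simp
  qed
  have "Cauchy u"
    unfolding Cauchy_altdef2
  proof (intro allI impI)
    fix e :: real assume e: "e > 0"
    then have "e\<^sup>2 / 8 > 0" by simp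
    then obtain N where N: "inverse (real (Suc N)) < e\<^sup>2 / 8"
      using reals_Archimedean by blast
    have "dist (u n) (u N) < e" if "n \<ge> N" for n
    proof -
      have "1 / real (Suc n) \<le> 1 / real (Suc N)"
        using that by (intro divide_left_mono) auto
      then have "(norm (u n - u N))\<^sup>2 < e\<^sup>2"
        using key[OF u(1) u(1), of n N] u(2)[of n] u(2)[of N] N by (simp add: inverse_eq_divide)
      then show ?thesis
        using e by (simp add: dist_norm power_less_imp_less_base)
    qed
    then show "\<exists>N. \<forall>n\<ge>N. dist (u n) (u N) < e" by blast
  qed
  then obtain q where q: "u \<longlonglongrightarrow> q"
    using Cauchy_convergent_iff convergent_def by blast
  have qH: "q \<in> H"
    using closed_sequentially[OF H(2) _ q] u(1) by (auto simp: D_def)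
  define c where "c k = ereal (I + 1 / real (Suc k) - 1/2 * (norm (v - u k))\<^sup>2)" for k
  have "c \<longlonglongrightarrow> ereal (I + 0 - 1/2 * (norm (v - q))\<^sup>2)"
    unfolding c_def using q by (intro tendsto_intros lim_1_over_real_power LIMSEQ_Suc[OF lim_1_over_n])
  moreover have "h (u k) \<le> c k" for k
  proof -
    have "u k \<in> H" "h (u k) < \<infinity>"
      using u(1)[of k] by (auto simp: D_def)
    then obtain r where "h (u k) = ereal r"
      using proper_fun_on_real[OF h(2)] by blast
    then show ?thesis
      using u(2)[of k] unfolding c_def \<phi>_def by simp
  qed
  ultimately have hq: "h q \<le> ereal (I + 0 - 1/2 * (norm (v - q))\<^sup>2)"
    using lsc_fun_on_le_limit[OF h(3) _ q qH] u(1) by (auto simp: D_def)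
  then have fin: "h q < \<infinity>"
    by (rule le_less_trans) simp
  have "real_of_ereal (h q) \<le> I - 1/2 * (norm (v - q))\<^sup>2"
  proof -
    obtain r where "h q = ereal r"
      using proper_fun_on_real[OF h(2) qH fin] by blast
    then show ?thesis using hq by simp
  qed
  then have "\<phi> q \<le> I" by (simp add: \<phi>_def)
  then show ?thesis
    using qH fin I_le unfolding \<phi>_def D_def by force
qed

text \<open>
  Optimality condition of the proximal minimisation: moving from the minimiser \<open>q\<close> a little towards
  \<open>u\<close> does not decrease the objective, and the quadratic term contributes only to second order.
\<close>

lemma prox_objective_min_variational:
  fixes H :: "'a::real_inner set"
  assumes H: "subspace H" and h: "convex_fun_on H h" "proper_fun_on H h"
    and q: "q \<in> H" "h q < \<infinity>"
    and min: "\<And>u. u \<in> H \<Longrightarrow> h u < \<infinity> \<Longrightarrow>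
      1/2 * (norm (v - q))\<^sup>2 + real_of_ereal (h q) \<le> 1/2 * (norm (v - u))\<^sup>2 + real_of_ereal (h u)"
    and u: "u \<in> H" "h u < \<infinity>"
  shows "real_of_ereal (h q) + (v - q) \<bullet> (u - q) \<le> real_of_ereal (h u)"
proof (rule ccontr)
  define c where "c = real_of_ereal (h q) + (v - q) \<bullet> (u - q) - real_of_ereal (h u)"
  define K where "K = (norm (u - q))\<^sup>2"
  assume "\<not> ?thesis"
  then have c: "c > 0" by (simp add: c_def)
  have K: "K \<ge> 0" by (simp add: K_def)
  \<comment> \<open>so small that the second order term \<open>t K / 2\<close> is below \<open>c\<close>\<close>
  define t where "t = min (1/2) (c / (K + 1))"
  have t: "0 < t" "t < 1" using c K by (auto simp: t_def)
  let ?w = "(1 - t) *\<^sub>R q + t *\<^sub>R u"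
  note w = convex_fun_on_real[OF h H q u t]
  have "v - ?w = (v - q) - t *\<^sub>R (u - q)"
    by (simp add: algebra_simps)
  then have "(norm (v - ?w))\<^sup>2 = (norm (v - q))\<^sup>2 - 2 * t * ((v - q) \<bullet> (u - q)) + t * (t * K)"
    unfolding power2_norm_eq_inner K_def
    by (simp only:) (simp add: inner_diff_left inner_diff_right inner_commute algebra_simps)
  then have "0 \<le> t * (t/2 * K - c)"
    using min[OF w(1,2)] w(3) unfolding c_def by (simp add: algebra_simps)
  then have "c \<le> t/2 * K"
    using t(1) by (simp add: zero_le_mult_iff)
  also have "\<dots> \<le> c / (K + 1) / 2 * K"
    using K by (intro mult_right_mono divide_right_mono) (auto simp: t_def)
  also have "\<dots> < c"
    using c K by (simp add: field_simps) (smt (verit) mult_nonneg_nonneg mult_pos_pos)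
  finally show False by simp
qed

lemma convex_fun_on_scale:
  assumes "convex_fun_on H h" "proper_fun_on H h" "c > 0"
  shows "convex_fun_on H (\<lambda>u. ereal c * h u)"
  unfolding convex_fun_on_def
proof (intro ballI allI impI)
  fix u v and t :: real assume *: "u \<in> H" "v \<in> H" "0 < t \<and> t < 1"
  have "ereal c * h ((1 - t) *\<^sub>R u + t *\<^sub>R v) \<le> ereal c * (ereal (1 - t) * h u + ereal t * h v)"
    using assms * by (intro ereal_mult_left_mono) (auto simp: convex_fun_on_def)
  also have "\<dots> = ereal (1 - t) * (ereal c * h u) + ereal t * (ereal c * h v)"
    using assms(2,3) * by (cases "h u"; cases "h v") (auto simp: proper_fun_on_def algebra_simps)
  finally show "ereal c * h ((1 - t) *\<^sub>R u + t *\<^sub>R v) \<le> ereal (1 - t) * (ereal c * h u) + ereal t * (ereal c * h v)" .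
qed

lemma lsc_fun_on_scale:
  assumes "lsc_fun_on H h" "c > 0"
  shows "lsc_fun_on H (\<lambda>u. ereal c * h u)"
  unfolding lsc_fun_on_def
proof
  fix u assume u: "u \<in> H"
  show "ereal c * h u \<le> Liminf (at u within H) (\<lambda>u. ereal c * h u)"
    unfolding le_Liminf_iff
  proof (intro allI impI)
    fix y assume y: "y < ereal c * h u"
    have "y / ereal c < h u"
      using y assms(2) by (subst ereal_divide_less_pos) auto
    then have "y / ereal c < Liminf (at u within H) h"
      using assms(1) u by (auto simp: lsc_fun_on_def intro: less_le_trans)
    then have "\<forall>\<^sub>F w in at u within H. y / ereal c < h w"
      by (rule less_LiminfD)
    then show "\<forall>\<^sub>F w in at u within H. y < ereal c * h w"
      by eventually_elim (use assms(2) in \<open>subst (asm) ereal_divide_less_pos; auto\<close>)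
  qed
qed

lemma scaled_less_infty_iff: "c > 0 \<Longrightarrow> ereal c * h < \<infinity> \<longleftrightarrow> h < \<infinity>"
  by (cases h) auto

lemma proper_fun_on_scale:
  assumes "proper_fun_on H h" "c > 0"
  shows "proper_fun_on H (\<lambda>u. ereal c * h u)"
  unfolding proper_fun_on_def
proof
  show "\<forall>u\<in>H. ereal c * h u \<noteq> - \<infinity>"
  proof
    fix u assume "u \<in> H"
    then show "ereal c * h u \<noteq> - \<infinity>"
      using assms by (cases "h u") (auto simp: proper_fun_on_def)
  qed
qed (use assms in \<open>auto simp: proper_fun_on_def scaled_less_infty_iff\<close>)

text \<open>
  The affine minorant keeps the proximal objective bounded below, since the quadratic term dominates
  every affine function. The last inequality says that \<open>(v - q) / c\<close> is a subgradient of \<open>h\<close> at \<open>q\<close>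
  relative to \<open>H\<close>.
\<close>

lemma prox_variational:
  fixes H :: "'a::{real_inner, complete_space} set" and v :: 'a
  assumes H: "subspace H" "closed H"
    and h: "convex_fun_on H h" "proper_fun_on H h" "lsc_fun_on H h"
    and minorant: "\<And>u. u \<in> H \<Longrightarrow> h u < \<infinity> \<Longrightarrow> a \<bullet> u + b \<le> real_of_ereal (h u)"
    and c: "c > 0"
  defines "q \<equiv> prox H (\<lambda>u. ereal c * h u) v"
  shows "q \<in> H" "h q < \<infinity>"
    and "\<And>u. u \<in> H \<Longrightarrow> h u < \<infinity> \<Longrightarrow>
           real_of_ereal (h q) + (1 / c) * ((v - q) \<bullet> (u - q)) \<le> real_of_ereal (h u)"
proof -
  let ?h = "\<lambda>u. ereal c * h u"
  note h' = convex_fun_on_scale[OF h(1,2) c] proper_fun_on_scale[OF h(2) c] lsc_fun_on_scale[OF h(3) c]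
  have real_h': "real_of_ereal (?h u) = c * real_of_ereal (h u)" for u
    by simp
  \<comment> \<open>the lower bound comes from completing the square, \<open>0 \<le> \<parallel>(v - u) - c a\<parallel>\<^sup>2\<close>\<close>
  have "- (1/2 * (norm (c *\<^sub>R a))\<^sup>2) + (c *\<^sub>R a) \<bullet> v + c * b \<le> 1/2 * (norm (v - u))\<^sup>2 + real_of_ereal (?h u)"
    if "u \<in> H" "?h u < \<infinity>" for u
  proof -
    have "a \<bullet> u + b \<le> real_of_ereal (h u)"
      using that c by (intro minorant) (auto simp: scaled_less_infty_iff)
    then have "c * (a \<bullet> u + b) \<le> real_of_ereal (?h u)"
      using c by simp
    moreover have "0 \<le> (norm ((v - u) - c *\<^sub>R a))\<^sup>2" by simp
    then have "0 \<le> (norm (v - u))\<^sup>2 - 2 * c * (a \<bullet> v) + 2 * c * (a \<bullet> u) + (norm (c *\<^sub>R a))\<^sup>2"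
      unfolding power2_norm_eq_inner
      by (simp add: inner_diff_left inner_diff_right inner_commute algebra_simps)
    ultimately show ?thesis by (simp add: algebra_simps)
  qed
  from prox_objective_attains_min[OF H h' this]
  obtain r where r: "r \<in> H" "?h r < \<infinity>" "\<And>u. u \<in> H \<Longrightarrow> ?h u < \<infinity> \<Longrightarrow>
      1/2 * (norm (v - r))\<^sup>2 + real_of_ereal (?h r) \<le> 1/2 * (norm (v - u))\<^sup>2 + real_of_ereal (?h u)"
    by blast
  define F where "F u = ereal (1 / 2 * (norm (v - u))\<^sup>2) + ?h u" for u
  have F_real: "F u = ereal (1/2 * (norm (v - u))\<^sup>2 + real_of_ereal (?h u))" if "u \<in> H" "?h u < \<infinity>" for u
  proof -
    from that have "\<exists>r. ?h u = ereal r"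
      by (intro proper_fun_on_real[OF h'(2)])
    then obtain r where "?h u = ereal r" by blast
    then show ?thesis by (simp add: F_def)
  qed
  have F_inf: "F u = \<infinity>" if "\<not> ?h u < \<infinity>" for u
    using that by (simp add: F_def)
  have "is_arg_min F (\<lambda>u. u \<in> H) r"
    unfolding is_arg_min_linorder
  proof (intro conjI allI impI)
    fix u assume u: "u \<in> H"
    show "F r \<le> F u"
    proof (cases "?h u < \<infinity>")
      case True
      then show ?thesis using F_real[OF u True] F_real[OF r(1,2)] r(3)[OF u True] by simp
    qed (simp add: F_inf)
  qed (fact r(1))
  then have "is_arg_min F (\<lambda>u. u \<in> H) q"
    unfolding q_def prox_def arg_min_on_def arg_min_def F_def by (rule someI)
  then have q: "q \<in> H" "\<And>u. u \<in> H \<Longrightarrow> F q \<le> F u"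
    by (auto simp: is_arg_min_linorder)
  have fin: "?h q < \<infinity>"
    using q(2)[OF r(1)] F_real[OF r(1,2)] F_inf[of q] by fastforce
  show "q \<in> H" "h q < \<infinity>"
    using q(1) fin c by (auto simp: scaled_less_infty_iff)
  fix u assume u: "u \<in> H" "h u < \<infinity>"
  have "real_of_ereal (?h q) + (v - q) \<bullet> (u - q) \<le> real_of_ereal (?h u)"
  proof (rule prox_objective_min_variational[OF H(1) h'(1,2) q(1) fin])
    fix w assume w: "w \<in> H" "?h w < \<infinity>"
    then show "1/2 * (norm (v - q))\<^sup>2 + real_of_ereal (?h q) \<le> 1/2 * (norm (v - w))\<^sup>2 + real_of_ereal (?h w)"
      using q(2)[OF w(1)] F_real[OF w] F_real[OF q(1) fin] by simp
  qed (use u c in \<open>auto simp: scaled_less_infty_iff\<close>)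
  then show "real_of_ereal (h q) + (1 / c) * ((v - q) \<bullet> (u - q)) \<le> real_of_ereal (h u)"
    using c by (simp add: field_simps)
qed

text \<open>
  The Riesz representation theorem is the special case of a linear \<open>h\<close>: minimising
  \<open>\<parallel>u\<parallel>\<^sup>2 / 2 - \<phi> u\<close> produces the representing vector.
\<close>

lemma riesz_representation:
  fixes \<phi> :: "'a::{real_inner, complete_space} \<Rightarrow> real"
  assumes "bounded_linear \<phi>"
  shows "\<exists>w. \<forall>u. \<phi> u = w \<bullet> u"
proof -
  interpret bounded_linear \<phi> by fact
  obtain K where K: "\<And>u. \<bar>\<phi> u\<bar> \<le> norm u * K"
    using bounded by (auto simp: real_norm_def)
  let ?h = "\<lambda>u. ereal (- \<phi> u)"
  have "lsc_fun_on UNIV ?h"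
    unfolding lsc_fun_on_def
  proof
    fix u
    have "(?h \<longlongrightarrow> ?h u) (at u)"
      by (intro tendsto_intros tendsto)
    then show "?h u \<le> Liminf (at u) ?h"
      by (metis lim_imp_Liminf order_refl trivial_limit_at Liminf_bot top_greatest top_ereal_def)
  qed
  moreover have "convex_fun_on UNIV ?h" "proper_fun_on UNIV ?h"
    by (auto simp: convex_fun_on_def proper_fun_on_def add diff scaleR algebra_simps)
  moreover have "- (1/2 * K\<^sup>2) \<le> 1/2 * (norm (0 - u))\<^sup>2 + real_of_ereal (?h u)" for u
  proof -
    have "0 \<le> (norm u - K)\<^sup>2" by simp
    then show ?thesis using K[of u] by (simp add: power2_eq_square algebra_simps)
  qed
  ultimately obtain q where q: "\<And>u. 1/2 * (norm (0 - q))\<^sup>2 + real_of_ereal (?h q)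
      \<le> 1/2 * (norm (0 - u))\<^sup>2 + real_of_ereal (?h u)"
    using prox_objective_attains_min[of UNIV ?h "- (1/2 * K\<^sup>2)" 0] by auto
  have ineq: "\<phi> d \<le> q \<bullet> d" for d
    using prox_objective_min_variational[of UNIV ?h q 0 "q + d"] q
      \<open>convex_fun_on UNIV ?h\<close> \<open>proper_fun_on UNIV ?h\<close>
    by (auto simp: add)
  have "\<phi> u = q \<bullet> u" for u
    using ineq[of u] ineq[of "- u"] by (simp add: neg)
  then show ?thesis by blast
qed

text \<open>
  Riesz' theorem, applied to \<open>x \<mapsto> T x \<bullet> y\<close>, shows that some map satisfies the property by which
  \<^const>\<open>adjoint\<close> is chosen.
\<close>

lemma hilbert_adjoint_works:
  fixes T :: "'a::{real_inner, complete_space} \<Rightarrow> 'c::real_inner"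
  assumes "bounded_linear T"
  shows "x \<bullet> adjoint T y = T x \<bullet> y"
proof -
  have "bounded_linear (\<lambda>x. T x \<bullet> y)" for y
    using assms by (rule bounded_linear_inner_left_comp)
  then have "\<forall>y. \<exists>w. \<forall>x. T x \<bullet> y = x \<bullet> w"
    using riesz_representation by (metis inner_commute)
  then have "\<exists>T'. \<forall>x y. T x \<bullet> y = x \<bullet> T' y" by metis
  then have "\<forall>x y. T x \<bullet> y = x \<bullet> adjoint T y"
    unfolding adjoint_def by (rule someI_ex)
  then show ?thesis by simp
qed

lemma hilbert_adjoint_bounded_linear:
  fixes T :: "'a::{real_inner, complete_space} \<Rightarrow> 'c::real_inner"
  assumes T: "bounded_linear T"
  shows "bounded_linear (adjoint T)"
proof -
  note adj = hilbert_adjoint_works[OF T]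
  obtain K where K: "\<And>x. norm (T x) \<le> norm x * K" "K \<ge> 0"
    using bounded_linear.nonneg_bounded[OF T] by auto
  show ?thesis
  proof (rule bounded_linear_intro)
    show "adjoint T (y + y') = adjoint T y + adjoint T y'" for y y'
      by (rule vector_eq_rdot[THEN iffD1]) (simp add: adj inner_commute[of _ "adjoint T _"]
          inner_commute[of "adjoint T _"] inner_add_right inner_add_left)
    show "adjoint T (r *\<^sub>R y) = r *\<^sub>R adjoint T y" for r y
      by (rule vector_eq_rdot[THEN iffD1]) (simp add: adj inner_commute[of "adjoint T _"])
    show "norm (adjoint T y) \<le> norm y * K" for y
    proof (cases "adjoint T y = 0")
      case False
      have "(norm (adjoint T y))\<^sup>2 = T (adjoint T y) \<bullet> y"
        by (simp add: power2_norm_eq_inner adj)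
      also have "\<dots> \<le> norm (T (adjoint T y)) * norm y"
        by (rule norm_cauchy_schwarz)
      also have "\<dots> \<le> norm (adjoint T y) * K * norm y"
        by (intro mult_right_mono K) auto
      finally show ?thesis using False by (simp add: power2_eq_square mult.commute mult.left_commute)
    qed (simp add: K)
  qed
qed

section \<open>Weak convergence\<close>

text \<open>For bounded sequences it suffices to test weak convergence on a dense set of vectors.\<close>

lemma inner_convergent_on_closure:
  fixes u :: "nat \<Rightarrow> 'a::real_inner"
  assumes bdd: "bounded (range u)" and D: "\<And>d. d \<in> D \<Longrightarrow> convergent (\<lambda>k. u k \<bullet> d)"
    and h: "h \<in> closure D"
  shows "convergent (\<lambda>k. u k \<bullet> h)"
proof -
  obtain K where K: "K > 0" "\<And>k. norm (u k) \<le> K"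
    using bdd by (auto simp: bounded_pos)
  have "Cauchy (\<lambda>k. u k \<bullet> h)"
    unfolding Cauchy_altdef2
  proof (intro allI impI)
    fix e :: real assume e: "e > 0"
    then obtain d where d: "d \<in> D" "dist d h < e / (4 * K)"
      using h K(1) unfolding closure_approachable by (meson divide_pos_pos mult_pos_pos zero_less_numeral)
    have "Cauchy (\<lambda>k. u k \<bullet> d)"
      using D[OF d(1)] by (rule convergent_Cauchy)
    then obtain N where N: "\<And>n. n \<ge> N \<Longrightarrow> dist (u n \<bullet> d) (u N \<bullet> d) < e / 2"
      unfolding Cauchy_altdef2 using e half_gt_zero by blast
    have "dist (u n \<bullet> h) (u N \<bullet> h) < e" if "n \<ge> N" for n
    proof -
      have 2: "norm (u n - u N) \<le> 2 * K"
        using norm_triangle_ineq4[of "u n" "u N"] K(2)[of n] K(2)[of N] by linarith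
      have "\<bar>(u n - u N) \<bullet> (h - d)\<bar> \<le> norm (u n - u N) * norm (h - d)"
        by (rule Cauchy_Schwarz_ineq2)
      also have "\<dots> \<le> (2 * K) * (e / (4 * K))"
        using 2 d(2) K(1) by (intro mult_mono) (auto simp: dist_norm norm_minus_commute)
      also have "\<dots> = e / 2" using K(1) by simp
      finally have "\<bar>(u n - u N) \<bullet> (h - d)\<bar> \<le> e / 2" .
      moreover have "u n \<bullet> h - u N \<bullet> h = (u n - u N) \<bullet> (h - d) + (u n \<bullet> d - u N \<bullet> d)"
        by (simp add: inner_diff_left inner_diff_right)
      ultimately show ?thesis using N[OF that] unfolding dist_real_def by linarith
    qed
    then show "\<exists>N. \<forall>n\<ge>N. dist (u n \<bullet> h) (u N \<bullet> h) < e" by blast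
  qed
  then show ?thesis by (rule real_Cauchy_convergent)
qed

text \<open>
  Sequential form of the weak compactness of balls. A diagonal argument makes \<open>u \<circ> r\<close> converge against
  a countable dense set of test vectors, and the limit functional is represented by a vector.
\<close>

lemma bounded_imp_weakly_convergent_subseq:
  fixes u :: "nat \<Rightarrow> 'a::{real_inner, complete_space, second_countable_topology}"
  assumes bdd: "bounded (range u)"
  shows "\<exists>w r. strict_mono r \<and> (\<forall>h. (\<lambda>k. u (r k) \<bullet> h) \<longlonglongrightarrow> w \<bullet> h)"
proof -
  obtain D :: "'a set" where D: "countable D" "closure D = UNIV"
    using separable[of "UNIV :: 'a set"] by (metis top.extremum_uniqueI)
  have ne: "D \<noteq> {}" using D(2) by auto
  obtain K where K: "K > 0" "\<And>k. norm (u k) \<le> K"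
    using bdd by (auto simp: bounded_pos)
  interpret subseqs "\<lambda>n s. convergent (\<lambda>k. u (s k) \<bullet> from_nat_into D n)"
  proof
    fix n and s :: "nat \<Rightarrow> nat"
    let ?v = "\<lambda>k. u (s k) \<bullet> from_nat_into D n"
    have "bounded (range ?v)"
      unfolding bounded_iff
    proof (intro exI ballI)
      fix x assume "x \<in> range ?v"
      then obtain k where "x = ?v k" by blast
      then show "norm x \<le> K * norm (from_nat_into D n)"
        using Cauchy_Schwarz_ineq2[of "u (s k)" "from_nat_into D n"]
          mult_right_mono[OF K(2)[of "s k"], of "norm (from_nat_into D n)"]
        by simp
    qed
    then show "\<exists>r'. strict_mono r' \<and> convergent (\<lambda>k. u ((s \<circ> r') k) \<bullet> from_nat_into D n)"
      using bounded_imp_convergent_subsequence[of ?v] by (auto simp: convergent_def o_def)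
  qed
  define r where "r = diagseq"
  have r: "strict_mono r"
    unfolding r_def by (rule subseq_diagseq)
  have "convergent (\<lambda>k. u (r k) \<bullet> d)" if "d \<in> D" for d
  proof -
    from that obtain n where n: "d = from_nat_into D n"
      using from_nat_into_surj[OF D(1)] by metis
    have "convergent (\<lambda>k. u ((diagseq \<circ> (+) (Suc n)) k) \<bullet> from_nat_into D n)"
    proof (rule diagseq_holds)
      fix q s :: "nat \<Rightarrow> nat" and n
      assume "strict_mono q" "convergent (\<lambda>k. u (s k) \<bullet> from_nat_into D n)"
      then show "convergent (\<lambda>k. u ((s \<circ> q) k) \<bullet> from_nat_into D n)"
        using convergent_subseq_convergent[of "\<lambda>k. u (s k) \<bullet> from_nat_into D n" q] by (simp add: o_def)
    qed
    then have "convergent (\<lambda>k. u (r (k + Suc n)) \<bullet> d)"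
      by (simp add: n r_def add.commute)
    then show ?thesis
      using convergent_ignore_initial_segment[of "\<lambda>k. u (r k) \<bullet> d" "Suc n"] by simp
  qed
  moreover have "bounded (range (\<lambda>k. u (r k)))"
    using bdd by (rule bounded_subset) auto
  ultimately have conv: "convergent (\<lambda>k. u (r k) \<bullet> h)" for h
    using inner_convergent_on_closure[of "\<lambda>k. u (r k)" D h] D(2) by simp
  define \<phi> where "\<phi> h = lim (\<lambda>k. u (r k) \<bullet> h)" for h
  have \<phi>: "(\<lambda>k. u (r k) \<bullet> h) \<longlonglongrightarrow> \<phi> h" for h
    using conv[of h] by (simp add: \<phi>_def convergent_LIMSEQ_iff)
  have "bounded_linear \<phi>"
  proof (rule bounded_linear_intro)
    fix a b :: 'a and c :: real
    show "\<phi> (a + b) = \<phi> a + \<phi> b"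
      using tendsto_add[OF \<phi>[of a] \<phi>[of b]] \<phi>[of "a + b"]
      by (intro LIMSEQ_unique) (simp_all add: inner_add_right)
    show "\<phi> (c *\<^sub>R a) = c *\<^sub>R \<phi> a"
      using tendsto_mult_left[OF \<phi>[of a], of c] \<phi>[of "c *\<^sub>R a"]
      by (intro LIMSEQ_unique) simp_all
    have "norm (u (r k) \<bullet> a) \<le> norm a * K" for k
      using Cauchy_Schwarz_ineq2[of "u (r k)" a] mult_right_mono[OF K(2)[of "r k"], of "norm a"]
      by (simp add: mult.commute)
    then show "norm (\<phi> a) \<le> norm a * K"
      by (intro LIMSEQ_le_const2[OF tendsto_norm[OF \<phi>]]) auto
  qed
  then obtain w where "\<And>h. \<phi> h = w \<bullet> h"
    using riesz_representation by blast
  then show ?thesis using r \<phi> by metis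
qed

text \<open>
  Opial's lemma for the inner product weighted by \<open>B\<close>. Instead of convergence of the weighted distances
  to \<open>c\<close> and \<open>c'\<close>, it assumes what this means for their difference, which for symmetric \<open>B\<close> is a
  constant plus a multiple of \<open>u k \<bullet> B (c - c')\<close>. Two weak cluster points \<open>w\<close>, \<open>w'\<close> then satisfy
  \<open>(w - w') \<bullet> B (w - w') = 0\<close>.
\<close>

lemma opial_weakly_convergent:
  fixes u :: "nat \<Rightarrow> 'a::{real_inner, complete_space, second_countable_topology}"
  assumes bdd: "bounded (range u)"
    and B: "bounded_linear B" "\<And>v. v \<bullet> B v = 0 \<Longrightarrow> v = 0"
    and C: "\<And>c c'. c \<in> C \<Longrightarrow> c' \<in> C \<Longrightarrow> convergent (\<lambda>k. u k \<bullet> B (c - c'))"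
    and Z: "Z \<subseteq> closure C"
    and cluster: "\<And>r w. strict_mono r \<Longrightarrow> (\<And>h. (\<lambda>k. u (r k) \<bullet> h) \<longlonglongrightarrow> w \<bullet> h) \<Longrightarrow> w \<in> Z"
  shows "\<exists>w\<in>Z. \<forall>h. (\<lambda>k. u k \<bullet> h) \<longlonglongrightarrow> w \<bullet> h"
proof -
  have conv: "convergent (\<lambda>k. u k \<bullet> B (z - z'))" if z: "z \<in> Z" "z' \<in> Z" for z z'
  proof (rule inner_convergent_on_closure[OF bdd])
    obtain c c' where c: "\<And>n. c n \<in> C" "c \<longlonglongrightarrow> z" "\<And>n. c' n \<in> C" "c' \<longlonglongrightarrow> z'"
      using z Z unfolding closure_sequential by (metis (no_types, lifting) closure_sequential subsetD)
    have "(\<lambda>n. B (c n - c' n)) \<longlonglongrightarrow> B (z - z')"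
      by (intro bounded_linear.tendsto[OF B(1)] tendsto_diff c)
    then show "B (z - z') \<in> closure {B (c - c') |c c'. c \<in> C \<and> c' \<in> C}"
      using c unfolding closure_sequential by (intro exI[of _ "\<lambda>n. B (c n - c' n)"]) auto
  qed (use C in blast)
  have unique: "w = w'"
    if r: "strict_mono r" "\<And>h. (\<lambda>k. u (r k) \<bullet> h) \<longlonglongrightarrow> w \<bullet> h"
      and r': "strict_mono r'" "\<And>h. (\<lambda>k. u (r' k) \<bullet> h) \<longlonglongrightarrow> w' \<bullet> h" for r r' w w'
  proof -
    obtain l where l: "(\<lambda>k. u k \<bullet> B (w - w')) \<longlonglongrightarrow> l"
      using conv[OF cluster[OF r] cluster[OF r']] by (auto simp: convergent_def)
    have "w \<bullet> B (w - w') = l" "w' \<bullet> B (w - w') = l"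
      using LIMSEQ_subseq_LIMSEQ[OF l r(1)] LIMSEQ_subseq_LIMSEQ[OF l r'(1)] r(2) r'(2)
      by (auto simp: o_def intro: LIMSEQ_unique)
    then have "(w - w') \<bullet> B (w - w') = 0"
      by (simp add: inner_diff_left)
    then show ?thesis using B(2) by force
  qed
  obtain r w where r: "strict_mono r" "\<And>h. (\<lambda>k. u (r k) \<bullet> h) \<longlonglongrightarrow> w \<bullet> h"
    using bounded_imp_weakly_convergent_subseq[OF bdd] by metis
  have "(\<lambda>k. u k \<bullet> h) \<longlonglongrightarrow> w \<bullet> h" for h
  proof (rule ccontr)
    assume "\<not> ?thesis"
    then obtain e where e: "e > 0" "\<exists>\<^sub>\<infinity>k. \<not> dist (u k \<bullet> h) (w \<bullet> h) < e"
      unfolding tendsto_iff by (auto simp: not_eventually cofinite_eq_sequentially)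
    then have "infinite {k. \<not> dist (u k \<bullet> h) (w \<bullet> h) < e}"
      by (simp add: frequently_cofinite)
    then obtain s :: "nat \<Rightarrow> nat" where s: "strict_mono s" "\<And>n. \<not> dist (u (s n) \<bullet> h) (w \<bullet> h) < e"
      using infinite_enumerate by blast
    have "bounded (range (\<lambda>k. u (s k)))"
      using bdd by (rule bounded_subset) auto
    then obtain q w' where q: "strict_mono q" "\<And>h. (\<lambda>k. u (s (q k)) \<bullet> h) \<longlonglongrightarrow> w' \<bullet> h"
      using bounded_imp_weakly_convergent_subseq[of "\<lambda>k. u (s k)"] by metis
    have "w' = w"
      using unique[of "s \<circ> q" w' r w] q r s(1) by (simp add: strict_mono_o)
    then have "\<forall>\<^sub>F k in sequentially. dist (u (s (q k)) \<bullet> h) (w \<bullet> h) < e"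
      using q(2)[of h] e(1) by (auto intro: tendstoD)
    then show False using s(2) by simp
  qed
  then show ?thesis using cluster[OF r] by blast
qed

text \<open>
  Testing a weak limit \<open>w\<close> against \<open>w - q\<close>, with \<open>q\<close> the projection of \<open>w\<close> onto \<open>H\<close>, shows \<open>w = q\<close>.
\<close>

lemma closed_subspace_weakly_closed:
  fixes H :: "'a::{real_inner, complete_space} set"
  assumes H: "subspace H" "closed H" and u: "\<And>k. u k \<in> H"
    and w: "\<And>h. (\<lambda>k. u k \<bullet> h) \<longlonglongrightarrow> w \<bullet> h"
  shows "w \<in> H"
proof -
  let ?h = "\<lambda>_::'a. 0 :: ereal"
  have h: "convex_fun_on H ?h" "proper_fun_on H ?h" "lsc_fun_on H ?h"
    using subspace_0[OF H(1)]
    by (auto simp: convex_fun_on_def proper_fun_on_def lsc_fun_on_def le_Liminf_iff)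
  obtain q where q: "q \<in> H" "\<And>v. v \<in> H \<Longrightarrow> 1/2 * (norm (w - q))\<^sup>2 + real_of_ereal (?h q)
      \<le> 1/2 * (norm (w - v))\<^sup>2 + real_of_ereal (?h v)"
    using prox_objective_attains_min[OF H h, of 0 w] by auto
  have le: "(w - q) \<bullet> d \<le> 0" if "d \<in> H" for d
    using prox_objective_min_variational[OF H(1) h(1,2) q(1) _ q(2), of "q + d"] q(1) that H(1)
    by (simp add: subspace_add)
  have "(w - q) \<bullet> (u k - q) = 0" for k
    using le[of "u k - q"] le[of "q - u k"] subspace_diff[OF H(1)] u q(1)
    by (smt (verit, ccfv_SIG) inner_minus_right minus_diff_eq)
  then have "u k \<bullet> (w - q) = q \<bullet> (w - q)" for k
    by (simp add: inner_diff_right inner_commute)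
  then have "w \<bullet> (w - q) = q \<bullet> (w - q)"
    using w[of "w - q"] LIMSEQ_unique[OF _ tendsto_const] by simp
  then have "(w - q) \<bullet> (w - q) = 0"
    by (simp add: inner_diff_left)
  then show ?thesis using q(1) by simp
qed

text \<open>
  Pettis' theorem: closed balls are cut out by countably many of the inequalities
  \<open>(w - a) \<bullet> d \<le> \<rho> * norm d\<close>, and in a separable space the balls generate the Borel sets.
\<close>

lemma borel_measurable_if_inner_measurable:
  fixes w :: "'w \<Rightarrow> 'a::{real_inner, second_countable_topology}"
  assumes meas: "\<And>h. (\<lambda>\<omega>. w \<omega> \<bullet> h) \<in> borel_measurable M"
  shows "w \<in> borel_measurable M"
proof (rule borel_measurableI)
  obtain D :: "'a set" where D: "countable D" "closure D = UNIV"
    using separable[of "UNIV :: 'a set"] by (metis top.extremum_uniqueI)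
  have norm_le: "norm x \<le> \<rho> \<longleftrightarrow> (\<forall>d\<in>D. x \<bullet> d \<le> \<rho> * norm d)" if "\<rho> \<ge> 0" for x :: 'a and \<rho>
  proof
    assume "norm x \<le> \<rho>"
    then show "\<forall>d\<in>D. x \<bullet> d \<le> \<rho> * norm d"
      by (meson norm_cauchy_schwarz mult_right_mono norm_ge_zero order_trans)
  next
    assume *: "\<forall>d\<in>D. x \<bullet> d \<le> \<rho> * norm d"
    have "closed {d. x \<bullet> d \<le> \<rho> * norm d}"
      by (intro closed_Collect_le continuous_intros)
    then have "closure D \<subseteq> {d. x \<bullet> d \<le> \<rho> * norm d}"
      using * by (intro closure_minimal) auto
    then have "x \<bullet> x \<le> \<rho> * norm x"
      using D(2) by blast
    then show "norm x \<le> \<rho>"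
      using that by (cases "x = 0") (auto simp: dot_square_norm power2_eq_square)
  qed
  have ball: "{\<omega> \<in> space M. w \<omega> \<in> cball a \<rho>} \<in> sets M" if "\<rho> \<ge> 0" for a \<rho>
  proof -
    have "w \<omega> \<in> cball a \<rho> \<longleftrightarrow> (\<forall>d\<in>D. w \<omega> \<bullet> d - a \<bullet> d \<le> \<rho> * norm d)" for \<omega>
      using norm_le[OF that, of "w \<omega> - a"] by (simp add: dist_norm norm_minus_commute inner_diff_left)
    then have "{\<omega> \<in> space M. w \<omega> \<in> cball a \<rho>}
        = {\<omega> \<in> space M. \<forall>d\<in>D. w \<omega> \<bullet> d - a \<bullet> d \<le> \<rho> * norm d}" by simp
    also have "\<dots> = (\<Inter>d\<in>D. {\<omega> \<in> space M. w \<omega> \<bullet> d - a \<bullet> d \<le> \<rho> * norm d})"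
      using D(2) by (cases "D = {}") auto
    also have "\<dots> \<in> sets M"
    proof (rule sets.countable_INT'[OF D(1)])
      have "{\<omega> \<in> space M. w \<omega> \<bullet> d - a \<bullet> d \<le> \<rho> * norm d} \<in> sets M" for d
      proof -
        have [measurable]: "(\<lambda>\<omega>. w \<omega> \<bullet> d) \<in> borel_measurable M" by (rule meas)
        show ?thesis by measurable
      qed
      then show "(\<lambda>d. {\<omega> \<in> space M. w \<omega> \<bullet> d - a \<bullet> d \<le> \<rho> * norm d}) ` D \<subseteq> sets M"
        by blast
    qed (use D(2) in auto)
    finally show ?thesis .
  qed
  fix V :: "'a set" assume V: "open V"
  define P where "P = {(d, \<rho>). d \<in> D \<and> \<rho> \<in> \<rat> \<and> \<rho> \<ge> 0 \<and> cball d \<rho> \<subseteq> V}"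
  have "P \<subseteq> D \<times> \<rat>" by (auto simp: P_def)
  then have "countable P"
    using D(1) countable_rat by (meson countable_SIGMA countable_subset)
  have "\<exists>(d, \<rho>)\<in>P. x \<in> cball d \<rho>" if "x \<in> V" for x
  proof -
    have "\<exists>e>0. cball x e \<subseteq> V"
      using V that unfolding open_contains_cball by (rule bspec)
    then obtain e where e: "e > 0" "cball x e \<subseteq> V" by (elim exE conjE)
    obtain \<rho> where \<rho>: "\<rho> \<in> \<rat>" "0 < \<rho>" "\<rho> < e / 2"
      using Rats_dense_in_real[of 0 "e / 2"] e(1) by auto
    obtain d where d: "d \<in> D" "dist d x < \<rho>"
      using D(2) \<rho>(2) by (metis UNIV_I closure_approachable)
    have "cball d \<rho> \<subseteq> cball x e"
    proof
      fix y assume "y \<in> cball d \<rho>"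
      then show "y \<in> cball x e"
        using d(2) \<rho>(3) dist_triangle[of x y d] by (simp add: dist_commute)
    qed
    then show ?thesis
      using d \<rho> e(2) by (intro bexI[of _ "(d, \<rho>)"]) (auto simp: P_def)
  qed
  then have "w -` V \<inter> space M = (\<Union>(d, \<rho>)\<in>P. {\<omega> \<in> space M. w \<omega> \<in> cball d \<rho>})"
    by (fastforce simp: P_def)
  also have "\<dots> \<in> sets M"
    using \<open>countable P\<close> ball by (intro sets.countable_UN') (auto simp: P_def)
  finally show "w -` V \<inter> space M \<in> sets M" .
qed

section \<open>Lyapunov functions for iterated random maps\<close>

text \<open>
  The first argument is the update map and the third the driving sequence; with a random driving
  sequence the iterates form a Markov chain.
\<close>

primrec iterate :: "('s \<Rightarrow> 't \<Rightarrow> 's) \<Rightarrow> 's \<Rightarrow> (nat \<Rightarrow> 't) \<Rightarrow> nat \<Rightarrow> 's" where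
  "iterate T s0 e 0 = s0"
| "iterate T s0 e (Suc k) = T (iterate T s0 e k) (e k)"

lemma iterate_cong: "(\<And>j. j < k \<Longrightarrow> e j = e' j) \<Longrightarrow> iterate T s0 e k = iterate T s0 e' k"
  by (induction k) auto

lemma finite_range_iterate:
  fixes T :: "'s \<Rightarrow> 't::finite \<Rightarrow> 's"
  shows "finite (range (\<lambda>e. iterate T s0 e k))"
proof (induction k)
  case (Suc k)
  have "range (\<lambda>e. iterate T s0 e (Suc k)) \<subseteq> (\<lambda>(s, t). T s t) ` (range (\<lambda>e. iterate T s0 e k) \<times> UNIV)"
    by force
  moreover have "finite (range (\<lambda>e. iterate T s0 e k) \<times> (UNIV :: 't set))"
    using Suc by simp
  ultimately show ?case
    using finite_subset finite_imageI by metis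
qed simp

locale iid_noise = prob_space M for M :: "'w measure" +
  fixes S :: "nat \<Rightarrow> 'w \<Rightarrow> 't::finite"
  assumes indep: "indep_vars (\<lambda>_. count_space UNIV) S UNIV"
    and ident: "\<And>k. distr M (count_space UNIV) (S k) = distr M (count_space UNIV) (S 0)"
begin

definition law :: "'t \<Rightarrow> real" where
  "law t = prob {\<omega> \<in> space M. S 0 \<omega> = t}"

abbreviation path :: "('s \<Rightarrow> 't \<Rightarrow> 's) \<Rightarrow> 's \<Rightarrow> nat \<Rightarrow> 'w \<Rightarrow> 's" where
  "path T s0 k \<omega> \<equiv> iterate T s0 (\<lambda>j. S j \<omega>) k"

lemma measurable_noise [measurable]: "S k \<in> measurable M (count_space UNIV)"
  using indep by (auto simp: indep_vars_def)

lemma prob_noise: "prob {\<omega> \<in> space M. S k \<omega> = t} = law t"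
proof -
  have "prob {\<omega> \<in> space M. S j \<omega> = t} = measure (distr M (count_space UNIV) (S j)) {t}" for j
    by (subst measure_distr) (auto intro!: arg_cong[where f = prob])
  then show ?thesis by (simp add: ident[of k] law_def)
qed

lemma measurable_path [measurable]: "path T s0 k \<in> measurable M (count_space UNIV)"
proof (induction k)
  case (Suc k)
  have "(\<lambda>\<omega>. T (path T s0 k \<omega>) t) \<in> measurable M (count_space UNIV)" for t
    using Suc by (rule measurable_compose) simp
  then show ?case
    unfolding iterate.simps
    by (rule measurable_compose_countable[where f = "\<lambda>t \<omega>. T (path T s0 k \<omega>) t", OF _ measurable_noise])
qed simp

lemma borel_measurable_path: "(\<lambda>\<omega>. h (path T s0 k \<omega>)) \<in> borel_measurable M"
  by (rule measurable_compose[OF measurable_path]) simp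

lemma integrable_path:
  fixes h :: "'s \<Rightarrow> real"
  shows "integrable M (\<lambda>\<omega>. h (path T s0 k \<omega>))"
proof (rule integrable_const_bound)
  let ?R = "range (\<lambda>e. iterate T s0 e k)"
  have "norm (h (path T s0 k \<omega>)) \<le> (\<Sum>s\<in>?R. norm (h s))" for \<omega>
    by (rule member_le_sum[where f = "\<lambda>s. norm (h s)"]) (auto simp: finite_range_iterate)
  then show "AE \<omega> in M. norm (h (path T s0 k \<omega>)) \<le> (\<Sum>s\<in>?R. norm (h s))" by simp
qed (rule borel_measurable_path)

text \<open>The state at time \<open>k\<close> depends on the noise before time \<open>k\<close> only.\<close>

lemma expectation_path_noise:
  fixes h :: "'s \<Rightarrow> real"
  shows "expectation (\<lambda>\<omega>. h (path T s0 k \<omega>) * (if S k \<omega> = t then 1 else 0))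
     = expectation (\<lambda>\<omega>. h (path T s0 k \<omega>)) * law t"
proof -
  let ?past = "\<lambda>\<omega>. restrict (\<lambda>i. S i \<omega>) {..<k}" and ?now = "\<lambda>\<omega>. restrict (\<lambda>i. S i \<omega>) {k}"
  let ?F = "\<lambda>e. h (iterate T s0 e k)" and ?G = "\<lambda>e. if e k = t then 1 else 0 :: real"
  have PiM: "PiM J (\<lambda>_. count_space UNIV) = count_space (PiE J (\<lambda>_. UNIV :: 't set))" if "finite J" for J :: "nat set"
    using that by (rule count_space_PiM_finite) auto
  have "indep_var (PiM {..<k} (\<lambda>_. count_space UNIV)) ?past (PiM {k} (\<lambda>_. count_space UNIV)) ?now"
    by (rule indep_var_restrict[OF indep]) auto
  then have "indep_var borel (?F \<circ> ?past) borel (?G \<circ> ?now)"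
    by (rule indep_var_compose) (auto simp: PiM)
  moreover have "?F \<circ> ?past = (\<lambda>\<omega>. h (path T s0 k \<omega>))"
    by (auto simp: fun_eq_iff intro!: arg_cong[where f = h] iterate_cong)
  moreover have "?G \<circ> ?now = (\<lambda>\<omega>. if S k \<omega> = t then 1 else 0)"
    by (auto simp: fun_eq_iff)
  ultimately have ind: "indep_var borel (\<lambda>\<omega>. h (path T s0 k \<omega>)) borel (\<lambda>\<omega>. if S k \<omega> = t then 1 else 0 :: real)"
    by simp
  have meas: "{\<omega> \<in> space M. S k \<omega> = t} \<in> sets M" by measurable
  have ifeq: "(\<lambda>\<omega>. if S k \<omega> = t then 1 else 0 :: real) = indicator {\<omega>. S k \<omega> = t}"
    by (auto simp: indicator_def)
  have int: "integrable M (\<lambda>\<omega>. if S k \<omega> = t then 1 else 0 :: real)"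
    by (rule integrable_const_bound[where B = 1]) auto
  have "expectation (\<lambda>\<omega>. if S k \<omega> = t then 1 else 0 :: real) = law t"
    unfolding ifeq by (simp add: prob_noise[of k t, symmetric] Int_def conj_commute)
  then show ?thesis
    using indep_var_lebesgue_integral[OF ind integrable_path int] by simp
qed

text \<open>The Markov property, integrated over the past.\<close>

lemma expectation_path_Suc:
  fixes h :: "'s \<Rightarrow> real"
  shows "expectation (\<lambda>\<omega>. h (path T s0 (Suc k) \<omega>))
     = expectation (\<lambda>\<omega>. \<Sum>t\<in>UNIV. law t * h (T (path T s0 k \<omega>) t))"
proof -
  let ?X = "path T s0 k"
  have "h (path T s0 (Suc k) \<omega>) = (\<Sum>t\<in>UNIV. h (T (?X \<omega>) t) * (if S k \<omega> = t then 1 else 0))" for \<omega>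
    by (simp add: sum.delta' if_distrib cong: if_cong)
  then have "expectation (\<lambda>\<omega>. h (path T s0 (Suc k) \<omega>))
      = expectation (\<lambda>\<omega>. \<Sum>t\<in>UNIV. h (T (?X \<omega>) t) * (if S k \<omega> = t then 1 else 0))" by presburger
  also have "\<dots> = (\<Sum>t\<in>UNIV. expectation (\<lambda>\<omega>. h (T (?X \<omega>) t) * (if S k \<omega> = t then 1 else 0)))"
  proof (rule Bochner_Integration.integral_sum)
    fix t
    show "integrable M (\<lambda>\<omega>. h (T (?X \<omega>) t) * (if S k \<omega> = t then 1 else 0))"
      by (rule Bochner_Integration.integrable_bound[OF integrable_path[of "\<lambda>s. h (T s t)" T s0 k]])
        (auto intro!: borel_measurable_times borel_measurable_path[of "\<lambda>s. h (T s t)"])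
  qed
  also have "\<dots> = (\<Sum>t\<in>UNIV. expectation (\<lambda>\<omega>. h (T (?X \<omega>) t)) * law t)"
    by (intro sum.cong refl expectation_path_noise[of "\<lambda>s. h (T s _)"])
  also have "\<dots> = (\<Sum>t\<in>UNIV. expectation (\<lambda>\<omega>. law t * h (T (?X \<omega>) t)))"
    by (simp add: mult.commute)
  also have "\<dots> = expectation (\<lambda>\<omega>. \<Sum>t\<in>UNIV. law t * h (T (?X \<omega>) t))"
    by (intro Bochner_Integration.integral_sum[symmetric] integrable_mult_right
        integrable_path[of "\<lambda>s. h (T s _)"])
  finally show ?thesis .
qed

lemma path_invariant:
  assumes "I s0" "\<And>s t. I s \<Longrightarrow> I (T s t)"
  shows "I (path T s0 k \<omega>)"
  by (induction k) (auto intro: assms)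

text \<open>
  As in the Robbins--Siegmund lemma, the expected decreases telescope, and their sum is bounded by the
  initial value of \<open>u\<close>.
\<close>

lemma lyapunov_expectation:
  assumes I: "I s0" "\<And>s t. I s \<Longrightarrow> I (T s t)"
    and u: "\<And>s. I s \<Longrightarrow> 0 \<le> u s"
    and step: "\<And>s. I s \<Longrightarrow> (\<Sum>t\<in>UNIV. law t * u (T s t)) \<le> u s - r s"
  shows "expectation (\<lambda>\<omega>. u (path T s0 n \<omega>)) + (\<Sum>k<n. expectation (\<lambda>\<omega>. r (path T s0 k \<omega>))) \<le> u s0"
proof (induction n)
  case (Suc n)
  have "expectation (\<lambda>\<omega>. u (path T s0 (Suc n) \<omega>))
      \<le> expectation (\<lambda>\<omega>. u (path T s0 n \<omega>) - r (path T s0 n \<omega>))"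
    unfolding expectation_path_Suc
    by (intro integral_mono Bochner_Integration.integrable_sum integrable_mult_right integrable_path[of "\<lambda>s. u (T s _)"]
        Bochner_Integration.integrable_diff integrable_path step path_invariant[of I] I)
  also have "\<dots> = expectation (\<lambda>\<omega>. u (path T s0 n \<omega>)) - expectation (\<lambda>\<omega>. r (path T s0 n \<omega>))"
    by (intro Bochner_Integration.integral_diff integrable_path)
  finally show ?case using Suc by simp
qed (simp add: prob_space)

lemma lyapunov_summable:
  assumes I: "I s0" "\<And>s t. I s \<Longrightarrow> I (T s t)"
    and u: "\<And>s. I s \<Longrightarrow> 0 \<le> u s" and r: "\<And>s. I s \<Longrightarrow> 0 \<le> r s"
    and step: "\<And>s. I s \<Longrightarrow> (\<Sum>t\<in>UNIV. law t * u (T s t)) \<le> u s - r s"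
  shows "AE \<omega> in M. summable (\<lambda>k. r (path T s0 k \<omega>))"
proof -
  note inv = path_invariant[of I, OF I]
  have "(\<Sum>k<n. ennreal (expectation (\<lambda>\<omega>. r (path T s0 k \<omega>)))) \<le> ennreal (u s0)" for n
  proof -
    have "0 \<le> expectation (\<lambda>\<omega>. u (path T s0 n \<omega>))"
      by (intro integral_nonneg_AE AE_I2 u inv)
    then have "(\<Sum>k<n. expectation (\<lambda>\<omega>. r (path T s0 k \<omega>))) \<le> u s0"
      using lyapunov_expectation[of I s0 T u r n, OF I u step] by simp
    moreover have "0 \<le> expectation (\<lambda>\<omega>. r (path T s0 k \<omega>))" for k
      by (intro integral_nonneg_AE AE_I2 r inv)
    ultimately show ?thesis
      by (subst sum_ennreal) (auto intro: ennreal_leI)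
  qed
  then have le: "(\<Sum>k. ennreal (expectation (\<lambda>\<omega>. r (path T s0 k \<omega>)))) \<le> ennreal (u s0)"
    by (intro suminf_le_const) auto
  have meas: "(\<lambda>\<omega>. ennreal (r (path T s0 k \<omega>))) \<in> borel_measurable M" for k
    by (rule borel_measurable_path)
  have "(\<integral>\<^sup>+\<omega>. (\<Sum>k. ennreal (r (path T s0 k \<omega>))) \<partial>M) = (\<Sum>k. \<integral>\<^sup>+\<omega>. ennreal (r (path T s0 k \<omega>)) \<partial>M)"
    by (rule nn_integral_suminf[OF meas])
  also have "\<dots> = (\<Sum>k. ennreal (expectation (\<lambda>\<omega>. r (path T s0 k \<omega>))))"
    by (intro suminf_cong nn_integral_eq_integral integrable_path AE_I2 r inv)
  finally have "(\<integral>\<^sup>+\<omega>. (\<Sum>k. ennreal (r (path T s0 k \<omega>))) \<partial>M) \<noteq> \<infinity>"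
    using le by (metis ennreal_neq_top infinity_ennreal_def neq_top_trans)
  then have "AE \<omega> in M. (\<Sum>k. ennreal (r (path T s0 k \<omega>))) \<noteq> \<infinity>"
    by (rule nn_integral_PInf_AE[rotated]) (intro borel_measurable_suminf_order meas)
  then show ?thesis
  proof eventually_elim
    case (elim \<omega>)
    then have "(\<Sum>k. ennreal (r (path T s0 k \<omega>))) \<noteq> top"
      unfolding infinity_ennreal_def .
    then show ?case
      by (rule summable_suminf_not_top[rotated]) (intro r inv)
  qed
qed

text \<open>
  Bookkeeping of upcrossings of \<open>[a, b]\<close>: \<open>H k\<close> says that the sequence has been below \<open>a\<close> and not yet
  back above \<open>b\<close>, and \<open>J (Suc k)\<close> that an upcrossing is completed at time \<open>Suc k\<close>.
\<close>

lemma finitely_many_upcrossings: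
  fixes v :: "nat \<Rightarrow> real"
  assumes H: "\<And>k. H (Suc k) \<longleftrightarrow> (if H k then v (Suc k) < b else v (Suc k) \<le> a)"
    and J: "\<And>k. J (Suc k) \<longleftrightarrow> H k \<and> b \<le> v (Suc k)"
    and fin: "\<forall>\<^sub>F k in sequentially. \<not> J k" and ab: "a < b"
  shows "(\<forall>\<^sub>F k in sequentially. a < v k) \<or> (\<forall>\<^sub>F k in sequentially. v k < b)"
proof (cases "\<forall>\<^sub>F k in sequentially. a < v k")
  case False
  obtain n where n: "\<And>k. k \<ge> n \<Longrightarrow> \<not> J k"
    using fin by (auto simp: eventually_sequentially)
  obtain m where m: "m \<ge> Suc n" "v m \<le> a"
    using False by (auto simp: eventually_sequentially not_less)
  then have Hm: "H m"
    using H[of "m - 1"] ab by (auto split: if_splits)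
  have "H k \<and> v k < b" if "k \<ge> m" for k
    using that
  proof (induction k rule: dec_induct)
    case base
    then show ?case using Hm m(2) ab by simp
  next
    case (step k)
    then have "\<not> J (Suc k)" using n[of "Suc k"] m(1) by simp
    with step show ?case using J[of k] H[of k] by auto
  qed
  then show ?thesis
    by (intro disjI2) (auto simp: eventually_sequentially)
qed simp

text \<open>
  Without crossings of rational intervals the sequence converges in \<open>[0, \<infinity>]\<close>. The limit inferior is
  smaller than some \<open>K\<close>, and as \<open>[K, K + 1]\<close> is not crossed infinitely often, the sequence is bounded.
\<close>

lemma convergent_if_no_crossings:
  fixes v :: "nat \<Rightarrow> real"
  assumes nonneg: "\<And>k. 0 \<le> v k"
    and cross: "\<And>a b. a \<in> \<rat> \<Longrightarrow> b \<in> \<rat> \<Longrightarrow> 0 \<le> a \<Longrightarrow> a < b \<Longrightarrow>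
      (\<forall>\<^sub>F k in sequentially. a < v k) \<or> (\<forall>\<^sub>F k in sequentially. v k < b)"
    and fin: "liminf (\<lambda>k. ennreal (v k)) \<noteq> \<infinity>"
  shows "convergent v"
proof -
  let ?v = "\<lambda>k. ereal (v k)"
  have "liminf (\<lambda>k. ennreal (v k)) < top"
    using fin by (simp add: less_top)
  then obtain K :: nat where K: "liminf (\<lambda>k. ennreal (v k)) < of_nat K"
    using ennreal_Ex_less_of_nat by blast
  have "\<not> (\<forall>\<^sub>F k in sequentially. real K < v k)"
  proof
    assume "\<forall>\<^sub>F k in sequentially. real K < v k"
    then have "\<forall>\<^sub>F k in sequentially. (of_nat K :: ennreal) \<le> ennreal (v k)"
      by eventually_elim (simp add: ennreal_of_nat_eq_real_of_nat ennreal_leI)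
    then have "of_nat K \<le> liminf (\<lambda>k. ennreal (v k))"
      by (rule Liminf_bounded)
    with K show False by simp
  qed
  then have "\<forall>\<^sub>F k in sequentially. v k < real K + 1"
    using cross[of "real K" "real K + 1"] by auto
  then have "\<forall>\<^sub>F k in sequentially. ?v k \<le> ereal (real K + 1)"
    by eventually_elim simp
  then have L: "limsup ?v \<le> ereal (real K + 1)"
    by (rule Limsup_bounded)
  have l: "0 \<le> liminf ?v"
    using nonneg by (intro Liminf_bounded) auto
  have le: "liminf ?v \<le> limsup ?v"
    by (rule Liminf_le_Limsup) simp
  have "liminf ?v = limsup ?v"
  proof (rule ccontr)
    assume ne: "liminf ?v \<noteq> limsup ?v"
    obtain l' where l': "liminf ?v = ereal l'"
      using l le L by (cases "liminf ?v") auto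
    obtain L' where L': "limsup ?v = ereal L'"
      using l le L by (cases "limsup ?v") auto
    have "l' < L'" using ne le l' L' by simp
    then obtain b where b: "b \<in> \<rat>" "l' < b" "b < L'"
      using Rats_dense_in_real by blast
    then obtain a where a: "a \<in> \<rat>" "l' < a" "a < b"
      using Rats_dense_in_real by blast
    have "0 \<le> a" using l l' a by simp
    from cross[OF a(1) b(1) this a(3)] show False
    proof
      assume "\<forall>\<^sub>F k in sequentially. a < v k"
      then have "\<forall>\<^sub>F k in sequentially. ereal a \<le> ?v k"
        by eventually_elim simp
      then have "ereal a \<le> liminf ?v" by (rule Liminf_bounded)
      then show False using l' a(2) by simp
    next
      assume "\<forall>\<^sub>F k in sequentially. v k < b"
      then have "\<forall>\<^sub>F k in sequentially. ?v k \<le> ereal b"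
        by eventually_elim simp
      then have "limsup ?v \<le> ereal b" by (rule Limsup_bounded)
      then show False using L' b(3) by simp
    qed
  qed
  moreover obtain L' where L': "limsup ?v = ereal L'"
    using l le L by (cases "limsup ?v") auto
  ultimately have "?v \<longlonglongrightarrow> ereal L'"
    by (subst tendsto_iff_Liminf_eq_Limsup) auto
  then have "v \<longlonglongrightarrow> L'" by simp
  then show ?thesis by (auto simp: convergent_def)
qed

text \<open>
  The state is augmented by the two flags of the upcrossing count. Betting on \<open>u\<close> while the first
  flag is set gives the augmented chain the Lyapunov function \<open>\<Psi>\<close>, which loses \<open>b - a\<close> at each
  completed upcrossing. By \<open>lyapunov_summable\<close> there are only finitely many.
\<close>

lemma lyapunov_no_crossings:
  fixes u :: "'s \<Rightarrow> real"
  assumes I: "I s0" "\<And>s t. I s \<Longrightarrow> I (T s t)"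
    and u: "\<And>s. I s \<Longrightarrow> 0 \<le> u s"
    and step: "\<And>s. I s \<Longrightarrow> (\<Sum>t\<in>UNIV. law t * u (T s t)) \<le> u s"
    and ab: "0 \<le> a" "a < b"
  shows "AE \<omega> in M. (\<forall>\<^sub>F k in sequentially. a < u (path T s0 k \<omega>)) \<or> (\<forall>\<^sub>F k in sequentially. u (path T s0 k \<omega>) < b)"
proof -
  define T' where "T' = (\<lambda>(s, h, j :: bool) t. (T s t,
    (if h then u (T s t) < b else u (T s t) \<le> a), h \<and> b \<le> u (T s t)))"
  define \<Psi> where "\<Psi> = (\<lambda>(s, h, j). (if h then u s - a else 0) + a + (if j then b - a else 0))"
  define r where "r = (\<lambda>(s :: 's, h :: bool, j). if j then b - a else 0)"
  define I' where "I' = (\<lambda>(s, h :: bool, j :: bool). I s)"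
  define s0' where "s0' = (s0, False, False)"
  \<comment> \<open>the constant chain shows that \<open>law\<close> has total mass one\<close>
  have law: "(\<Sum>t\<in>UNIV. law t) = 1" "\<And>t. 0 \<le> law t"
    using expectation_path_Suc[of "\<lambda>_. 1" "\<lambda>s t. s" s0 0] by (auto simp: prob_space law_def)
  have "AE \<omega> in M. summable (\<lambda>k. r (path T' s0' k \<omega>))"
  proof (rule lyapunov_summable[of I' s0' T' \<Psi> r])
    show "I' s0'" using I by (simp add: I'_def s0'_def)
    show "I' (T' s t)" if "I' s" for s t
      using that I by (auto simp: I'_def T'_def split: prod.splits)
    show "0 \<le> \<Psi> s" if "I' s" for s
      using that u ab by (auto simp: I'_def \<Psi>_def split: prod.splits)
    show "0 \<le> r s" if "I' s" for s
      using ab by (auto simp: r_def split: prod.splits)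
    show "(\<Sum>t\<in>UNIV. law t * \<Psi> (T' s t)) \<le> \<Psi> s - r s" if "I' s" for s
    proof -
      obtain x h j where s: "s = (x, h, j)" by (cases s)
      have Ix: "I x" using that by (simp add: I'_def s)
      have "\<Psi> (T' s t) \<le> (if h then u (T x t) else a)" for t
        using ab by (auto simp: s T'_def \<Psi>_def)
      then have "(\<Sum>t\<in>UNIV. law t * \<Psi> (T' s t)) \<le> (\<Sum>t\<in>UNIV. law t * (if h then u (T x t) else a))"
        by (intro sum_mono mult_left_mono law(2))
      also have "\<dots> \<le> (if h then u x else a)"
        using step[OF Ix] law(1) by (simp flip: sum_distrib_right)
      also have "\<dots> = \<Psi> s - r s"
        by (simp add: s \<Psi>_def r_def)
      finally show ?thesis .
    qed
  qed
  then show ?thesis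
  proof eventually_elim
    case (elim \<omega>)
    let ?X = "\<lambda>k. path T' s0' k \<omega>"
    have fst_X: "fst (?X k) = path T s0 k \<omega>" for k
      by (induction k) (auto simp: s0'_def T'_def split_beta)
    have "(\<lambda>k. r (?X k)) \<longlonglongrightarrow> 0"
      using elim by (rule summable_LIMSEQ_zero)
    then have "\<forall>\<^sub>F k in sequentially. r (?X k) < b - a"
      using ab by (intro order_tendstoD) auto
    then have "\<forall>\<^sub>F k in sequentially. \<not> snd (snd (?X k))"
      by eventually_elim (auto simp: r_def split_beta)
    then show ?case
      by (intro finitely_many_upcrossings[where H = "\<lambda>k. fst (snd (?X k))" and J = "\<lambda>k. snd (snd (?X k))"])
        (auto simp: fst_X[symmetric] T'_def split_beta ab)
  qed
qed

text \<open>By Fatou's lemma the limit inferior of \<open>u\<close> along the path is almost surely finite.\<close>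

lemma lyapunov_convergent:
  fixes u :: "'s \<Rightarrow> real"
  assumes I: "I s0" "\<And>s t. I s \<Longrightarrow> I (T s t)"
    and u: "\<And>s. I s \<Longrightarrow> 0 \<le> u s"
    and step: "\<And>s. I s \<Longrightarrow> (\<Sum>t\<in>UNIV. law t * u (T s t)) \<le> u s"
  shows "AE \<omega> in M. convergent (\<lambda>k. u (path T s0 k \<omega>))"
proof -
  note inv = path_invariant[of I, OF I]
  have meas: "(\<lambda>\<omega>. ennreal (u (path T s0 k \<omega>))) \<in> borel_measurable M" for k
    by (rule borel_measurable_path)
  have "(\<integral>\<^sup>+\<omega>. ennreal (u (path T s0 k \<omega>)) \<partial>M) \<le> ennreal (u s0)" for k
    using lyapunov_expectation[of I s0 T u "\<lambda>_. 0" k] I u step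
    by (subst nn_integral_eq_integral) (auto intro!: integrable_path ennreal_leI AE_I2 u inv)
  then have "liminf (\<lambda>k. \<integral>\<^sup>+\<omega>. ennreal (u (path T s0 k \<omega>)) \<partial>M) \<le> ennreal (u s0)"
    by (intro order_trans[OF Liminf_le_Limsup Limsup_bounded]) auto
  then have "(\<integral>\<^sup>+\<omega>. liminf (\<lambda>k. ennreal (u (path T s0 k \<omega>))) \<partial>M) \<le> ennreal (u s0)"
    using nn_integral_liminf[of "\<lambda>k \<omega>. ennreal (u (path T s0 k \<omega>))" M, OF meas] by (rule order_trans[rotated])
  then have "(\<integral>\<^sup>+\<omega>. liminf (\<lambda>k. ennreal (u (path T s0 k \<omega>))) \<partial>M) \<noteq> \<infinity>"
    by (metis ennreal_neq_top infinity_ennreal_def neq_top_trans)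
  then have "AE \<omega> in M. liminf (\<lambda>k. ennreal (u (path T s0 k \<omega>))) \<noteq> \<infinity>"
    by (rule nn_integral_PInf_AE[rotated]) (intro borel_measurable_liminf meas)
  moreover have "AE \<omega> in M. \<forall>(a, b)\<in>{(a, b). a \<in> \<rat> \<and> b \<in> \<rat> \<and> 0 \<le> a \<and> a < b}.
      (\<forall>\<^sub>F k in sequentially. a < u (path T s0 k \<omega>)) \<or> (\<forall>\<^sub>F k in sequentially. u (path T s0 k \<omega>) < b)"
  proof (rule AE_ball_countable')
    have "countable (\<rat> \<times> \<rat> :: (real \<times> real) set)"
      using countable_rat by blast
    then show "countable {(a, b :: real). a \<in> \<rat> \<and> b \<in> \<rat> \<and> 0 \<le> a \<and> a < b}"
      by (rule countable_subset[rotated]) auto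
  qed (use lyapunov_no_crossings[of I s0 T u, OF I u step] in auto)
  ultimately show ?thesis
  proof eventually_elim
    case (elim \<omega>)
    show ?case
      by (rule convergent_if_no_crossings) (use elim u inv in auto)
  qed
qed

end

section \<open>Convex conjugates\<close>

lemma conjugate_ge:
  "u \<in> H \<Longrightarrow> ereal (u \<bullet> y) - h u \<le> conjugate H h y"
  unfolding conjugate_def by (rule SUP_upper)

lemma conjugate_not_MInf:
  assumes "proper_fun_on H h"
  shows "conjugate H h y \<noteq> -\<infinity>"
proof -
  obtain u c where "u \<in> H" "h u = ereal c"
    using assms unfolding proper_fun_on_def by (metis ereal_cases less_irrefl)
  then show ?thesis using conjugate_ge[of u H y h] by auto
qed

text \<open>A conjugate is a supremum of affine functions; one of them serves as minorant.\<close>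

lemma conjugate_affine_minorant:
  assumes "proper_fun_on H h"
  shows "\<exists>a b. \<forall>y. conjugate H h y < \<infinity> \<longrightarrow> a \<bullet> y + b \<le> real_of_ereal (conjugate H h y)"
proof -
  obtain u c where u: "u \<in> H" "h u = ereal c"
    using assms unfolding proper_fun_on_def by (metis ereal_cases less_irrefl)
  have "u \<bullet> y + (- c) \<le> real_of_ereal (conjugate H h y)" if "conjugate H h y < \<infinity>" for y
    using conjugate_ge[of u H y h] u that by (cases "conjugate H h y") auto
  then show ?thesis by blast
qed

lemma convex_fun_on_conjugate:
  assumes "proper_fun_on H h"
  shows "convex_fun_on H' (conjugate H h)"
  unfolding convex_fun_on_def
proof (intro ballI allI impI)
  fix y v :: 'a and t :: real assume t: "0 < t \<and> t < 1"
  let ?R = "ereal (1 - t) * conjugate H h y + ereal t * conjugate H h v"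
  show "conjugate H h ((1 - t) *\<^sub>R y + t *\<^sub>R v) \<le> ?R"
    unfolding conjugate_def[of H h "(1 - t) *\<^sub>R y + t *\<^sub>R v"]
  proof (rule SUP_least)
    fix u assume u: "u \<in> H"
    show "ereal (u \<bullet> ((1 - t) *\<^sub>R y + t *\<^sub>R v)) - h u \<le> ?R"
    proof (cases "h u")
      case (real c)
      have "ereal (u \<bullet> ((1 - t) *\<^sub>R y + t *\<^sub>R v)) - h u
          = ereal (1 - t) * (ereal (u \<bullet> y) - h u) + ereal t * (ereal (u \<bullet> v) - h u)"
        by (simp add: real inner_add_right algebra_simps)
      also have "\<dots> \<le> ?R"
        using t by (intro add_mono ereal_mult_left_mono conjugate_ge u) auto
      finally show ?thesis .
    next
      case MInf
      then show ?thesis using assms u by (auto simp: proper_fun_on_def)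
    qed simp
  qed
qed

lemma lsc_fun_on_conjugate:
  assumes "proper_fun_on H h"
  shows "lsc_fun_on H' (conjugate H h)"
  unfolding lsc_fun_on_def le_Liminf_iff
proof (intro ballI allI impI)
  fix v y assume "y < conjugate H h v"
  then obtain u where u: "u \<in> H" "y < ereal (u \<bullet> v) - h u"
    unfolding conjugate_def less_SUP_iff by blast
  obtain c where c: "h u = ereal c"
    using assms u by (cases "h u") (auto simp: proper_fun_on_def)
  have "((\<lambda>w. ereal (u \<bullet> w - c)) \<longlongrightarrow> ereal (u \<bullet> v - c)) (at v within H')"
    by (intro tendsto_intros)
  then have "\<forall>\<^sub>F w in at v within H'. y < ereal (u \<bullet> w - c)"
    using u(2) c by (intro order_tendstoD(1)) auto
  then show "\<forall>\<^sub>F w in at v within H'. y < conjugate H h w"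
  proof eventually_elim
    case (elim w)
    then show ?case using conjugate_ge[OF u(1), of w h] c by (auto intro: less_le_trans)
  qed
qed

section \<open>Products of Hilbert spaces, operator norms and averages\<close>

lemma power2_norm_vec: "(norm (y :: 'b::real_inner ^ 'n))\<^sup>2 = (\<Sum>i\<in>UNIV. (norm (y $ i))\<^sup>2)"
  by (simp add: power2_norm_eq_inner inner_vec_def)

lemma norm_vec_le_sum: "norm (y :: 'b::real_inner ^ 'n) \<le> (\<Sum>i\<in>UNIV. norm (y $ i))"
  unfolding norm_vec_def by (rule L2_set_le_sum) simp

lemma bounded_linear_vecI:
  fixes T :: "'a::real_normed_vector \<Rightarrow> 'b::real_inner ^ 'n"
  assumes "\<And>i. bounded_linear (\<lambda>u. T u $ i)"
  shows "bounded_linear T"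
proof -
  obtain K where K: "\<And>i u. norm (T u $ i) \<le> norm u * K i"
    using bounded_linear.bounded[OF assms] by metis
  show ?thesis
  proof (rule bounded_linear_intro)
    show "T (u + v) = T u + T v" for u v
      by (simp add: vec_eq_iff linear_add[OF bounded_linear.linear[OF assms]])
    show "T (r *\<^sub>R u) = r *\<^sub>R T u" for r u
      by (simp add: vec_eq_iff linear_scale[OF bounded_linear.linear[OF assms]])
    show "norm (T u) \<le> norm u * (\<Sum>i\<in>UNIV. K i)" for u
      unfolding sum_distrib_left by (rule order_trans[OF norm_vec_le_sum sum_mono[OF K]])
  qed
qed

lemma bdd_above_norm_ratio:
  assumes "bounded_linear T"
  shows "bdd_above ((\<lambda>v. norm (T v) / norm v) ` H)"
proof -
  obtain K where K: "\<And>v. norm (T v) \<le> norm v * K" "K \<ge> 0"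
    using bounded_linear.nonneg_bounded[OF assms] by auto
  have "norm (T v) / norm v \<le> K" for v
    using K by (cases "v = 0") (auto simp: divide_le_eq mult.commute)
  then show ?thesis by (intro bdd_aboveI2)
qed

lemma onorm_on_bound:
  assumes "bounded_linear T" "u \<in> H"
  shows "norm (T u) \<le> onorm_on H T * norm u"
proof (cases "u = 0")
  case True
  then show ?thesis using bounded_linear.linear[OF assms(1)] by (simp add: linear_0)
next
  case False
  have "norm (T u) / norm u \<le> onorm_on H T"
    unfolding onorm_on_def using assms by (intro cSUP_upper bdd_above_norm_ratio)
  then show ?thesis using False by (simp add: divide_le_eq)
qed

lemma onorm_on_nonneg:
  assumes "bounded_linear T" "u \<in> H"
  shows "0 \<le> onorm_on H T"
  unfolding onorm_on_def using bdd_above_norm_ratio[OF assms(1)] assms(2)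
  by (intro cSUP_upper2[where x = u]) auto

lemma inner_polarization:
  "(a - b) \<bullet> (c - b) = 1/2 * ((norm (b - a))\<^sup>2 + (norm (b - c))\<^sup>2 - (norm (a - c))\<^sup>2)"
  unfolding power2_norm_eq_inner
  by (simp add: inner_diff_left inner_diff_right inner_commute algebra_simps)

text \<open>
  The values lie in a space that need not be of class \<^class>\<open>banach\<close>, so the Bochner integral is computed from its
  definition on finite sums of indicators.
\<close>

lemma (in iid_noise) integral_noise:
  fixes \<phi> :: "'t \<Rightarrow> 'c::{real_normed_vector, second_countable_topology}"
  shows "(LINT \<omega>|M. \<phi> (S 0 \<omega>)) = (\<Sum>t\<in>UNIV. law t *\<^sub>R \<phi> t)"
proof -
  have meas: "{\<omega> \<in> space M. S 0 \<omega> = t} \<in> sets M" for t by measurable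
  have "has_bochner_integral M (\<lambda>\<omega>. \<Sum>t\<in>UNIV. indicator {\<omega> \<in> space M. S 0 \<omega> = t} \<omega> *\<^sub>R \<phi> t)
      (\<Sum>t\<in>UNIV. law t *\<^sub>R \<phi> t)"
    unfolding law_def
    by (intro has_bochner_integral_sum has_bochner_integral_scaleR_left has_bochner_integral_real_indicator meas)
      (simp add: less_top[symmetric])
  moreover have "(\<Sum>t\<in>UNIV. indicator {\<omega> \<in> space M. S 0 \<omega> = t} \<omega> *\<^sub>R \<phi> t) = \<phi> (S 0 \<omega>)"
    if "\<omega> \<in> space M" for \<omega>
  proof -
    have "(\<Sum>t\<in>UNIV. indicator {\<omega> \<in> space M. S 0 \<omega> = t} \<omega> *\<^sub>R \<phi> t) = (\<Sum>t\<in>UNIV. if S 0 \<omega> = t then \<phi> t else 0)"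
      using that by (intro sum.cong) (auto simp: indicator_def)
    then show ?thesis by simp
  qed
  ultimately have "has_bochner_integral M (\<lambda>\<omega>. \<phi> (S 0 \<omega>)) (\<Sum>t\<in>UNIV. law t *\<^sub>R \<phi> t)"
    by (subst (asm) has_bochner_integral_cong[OF refl _ refl]) auto
  then show ?thesis by (rule has_bochner_integral_integral_eq)
qed

section \<open>The algorithm as an iterated random map\<close>

locale spdhg_problem = iid_noise M S
  for M :: "'w measure" and S :: "nat \<Rightarrow> 'w \<Rightarrow> 'n::finite set" +
  fixes Y :: "'n \<Rightarrow> 'b::{real_inner, complete_space, second_countable_topology} set"
    and A :: "'n \<Rightarrow> 'x::{real_inner, complete_space, second_countable_topology} \<Rightarrow> 'b"
    and g :: "'x \<Rightarrow> ereal" and f :: "'n \<Rightarrow> 'b \<Rightarrow> ereal"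
    and \<tau> :: real and \<sigma> :: "'n \<Rightarrow> real"
  assumes Y: "\<And>i. subspace (Y i)" "\<And>i. closed (Y i)"
    and A: "\<And>i. bounded_linear (A i)" "\<And>i x. A i x \<in> Y i"
    and g: "convex_fun_on UNIV g" "proper_fun_on UNIV g" "lsc_fun_on UNIV g"
    and f: "\<And>i. proper_fun_on (Y i) (f i)"
    and steps: "\<tau> > 0" "\<And>i. \<sigma> i > 0"
    and saddle: "\<exists>w. saddle_point Y A g f w"
    and prox_g: "weakly_seq_continuous_on UNIV (prox UNIV (\<lambda>u. ereal \<tau> * g u))"
    and prox_f: "\<And>i. weakly_seq_continuous_on (Y i)
                   (prox (Y i) (\<lambda>u. ereal (\<sigma> i) * conjugate (Y i) (f i) u))"
    and sampling_proper: "\<And>i. inclusion_prob M (S 0) i > 0"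
    and D: "onorm_on (prod_space Y) (step_op M (S 0) A \<tau> \<sigma>) < 1"
begin

abbreviation p :: "'n \<Rightarrow> real" where "p \<equiv> inclusion_prob M (S 0)"

abbreviation fc :: "'n \<Rightarrow> 'b \<Rightarrow> ereal" where "fc i \<equiv> conjugate (Y i) (f i)"

definition G :: "'x \<Rightarrow> real" where "G u = real_of_ereal (g u)"

definition F :: "'n \<Rightarrow> 'b \<Rightarrow> real" where "F i v = real_of_ereal (fc i v)"

definition A_adj :: "'b ^ 'n \<Rightarrow> 'x" where
  "A_adj y = (\<Sum>i\<in>UNIV. adjoint (A i) (y $ i))"

lemma adjoint_A_inner: "adjoint (A i) v \<bullet> h = A i h \<bullet> v"
  by (subst inner_commute) (rule hilbert_adjoint_works[OF A(1)])

lemma A_adj_inner: "A_adj y \<bullet> h = (\<Sum>i\<in>UNIV. A i h \<bullet> y $ i)"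
  by (simp add: A_adj_def inner_sum_left adjoint_A_inner)

lemma A_diff: "A i (u - v) = A i u - A i v"
  using bounded_linear.linear[OF A(1)] by (rule linear_diff)

lemma adjoint_A_add: "adjoint (A i) (u + v) = adjoint (A i) u + adjoint (A i) v"
  using bounded_linear.linear[OF hilbert_adjoint_bounded_linear[OF A(1)]] by (rule linear_add)

subsection \<open>Saddle points in terms of finite function values\<close>

lemma lagrangian_real:
  assumes "g x < \<infinity>" "\<And>i. fc i (y $ i) < \<infinity>"
  shows "lagrangian Y A g f x y = ereal ((\<Sum>i\<in>UNIV. A i x \<bullet> y $ i - F i (y $ i)) + G x)"
proof -
  have "g x = ereal (G x)"
    using g(2) assms(1) by (cases "g x") (auto simp: G_def proper_fun_on_def)
  moreover have "fc i (y $ i) = ereal (F i (y $ i))" for i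
    using conjugate_not_MInf[OF f, of i "y $ i"] assms(2)[of i] by (cases "fc i (y $ i)") (auto simp: F_def)
  ultimately show ?thesis by (simp add: lagrangian_def)
qed

lemma saddle_point_iff:
  "saddle_point Y A g f (x, y) \<longleftrightarrow> y \<in> prod_space Y \<and> g x < \<infinity> \<and> (\<forall>i. fc i (y $ i) < \<infinity>) \<and>
     (\<forall>v\<in>prod_space Y. (\<forall>i. fc i (v $ i) < \<infinity>) \<longrightarrow>
        (\<Sum>i\<in>UNIV. A i x \<bullet> v $ i - F i (v $ i)) \<le> (\<Sum>i\<in>UNIV. A i x \<bullet> y $ i - F i (y $ i))) \<and>
     (\<forall>u. g u < \<infinity> \<longrightarrow> A_adj y \<bullet> x + G x \<le> A_adj y \<bullet> u + G u)"
  by (auto simp: saddle_point_def lagrangian_real A_adj_inner sum_subtractf)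

subsection \<open>The proximal steps\<close>

definition prox_primal :: "'x \<Rightarrow> 'x" where
  "prox_primal = prox UNIV (\<lambda>u. ereal \<tau> * g u)"

definition prox_dual :: "'n \<Rightarrow> 'b \<Rightarrow> 'b" where
  "prox_dual i = prox (Y i) (\<lambda>u. ereal (\<sigma> i) * fc i u)"

text \<open>At a saddle point \<open>(x, y)\<close>, minimality of \<open>x\<close> provides the affine minorant of \<open>g\<close>.\<close>

lemma prox_primal:
  shows "g (prox_primal v) < \<infinity>"
    and "g u < \<infinity> \<Longrightarrow> G (prox_primal v) + (1 / \<tau>) * ((v - prox_primal v) \<bullet> (u - prox_primal v)) \<le> G u"
proof -
  obtain x y where "saddle_point Y A g f (x, y)"
    using saddle by auto
  then have "(- A_adj y) \<bullet> u + (A_adj y \<bullet> x + G x) \<le> real_of_ereal (g u)" if "g u < \<infinity>" for u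
    using that by (force simp: saddle_point_iff G_def[of u])
  note * = prox_variational[OF subspace_UNIV closed_UNIV g this steps(1), where v = v]
  show "g (prox_primal v) < \<infinity>"
    unfolding prox_primal_def using * by blast
  show "g u < \<infinity> \<Longrightarrow> G (prox_primal v) + (1 / \<tau>) * ((v - prox_primal v) \<bullet> (u - prox_primal v)) \<le> G u"
    unfolding prox_primal_def G_def using * by blast
qed

lemma prox_dual:
  shows "prox_dual i v \<in> Y i" "fc i (prox_dual i v) < \<infinity>"
    and "u \<in> Y i \<Longrightarrow> fc i u < \<infinity> \<Longrightarrow>
      F i (prox_dual i v) + (1 / \<sigma> i) * ((v - prox_dual i v) \<bullet> (u - prox_dual i v)) \<le> F i u"
proof -
  have "\<exists>y\<in>Y i. fc i y < \<infinity>"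
    using saddle by (auto simp: saddle_point_def prod_space_def)
  then have proper: "proper_fun_on (Y i) (fc i)"
    using conjugate_not_MInf[OF f] by (auto simp: proper_fun_on_def)
  obtain a b where ab: "\<And>y. fc i y < \<infinity> \<Longrightarrow> a \<bullet> y + b \<le> real_of_ereal (fc i y)"
    using conjugate_affine_minorant[OF f] by metis
  note * = prox_variational[OF Y convex_fun_on_conjugate[OF f] proper lsc_fun_on_conjugate[OF f] ab steps(2)]
  show "prox_dual i v \<in> Y i" "fc i (prox_dual i v) < \<infinity>"
    unfolding prox_dual_def using * by blast+
  show "u \<in> Y i \<Longrightarrow> fc i u < \<infinity> \<Longrightarrow>
      F i (prox_dual i v) + (1 / \<sigma> i) * ((v - prox_dual i v) \<bullet> (u - prox_dual i v)) \<le> F i u"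
    unfolding prox_dual_def F_def using * by blast
qed

subsection \<open>One step of the algorithm\<close>

definition x_next :: "'x \<Rightarrow> 'x \<Rightarrow> 'x" where
  "x_next x zb = prox_primal (x - \<tau> *\<^sub>R zb)"

text \<open>The dual iterate that the full sampling would produce.\<close>

definition y_full :: "'x \<Rightarrow> 'b ^ 'n \<Rightarrow> 'x \<Rightarrow> 'b ^ 'n" where
  "y_full x y zb = (\<chi> i. prox_dual i (y $ i + \<sigma> i *\<^sub>R A i (x_next x zb)))"

definition y_next :: "'x \<Rightarrow> 'b ^ 'n \<Rightarrow> 'x \<Rightarrow> 'n set \<Rightarrow> 'b ^ 'n" where
  "y_next x y zb t = (\<chi> i. if i \<in> t then y_full x y zb $ i else y $ i)"

text \<open>The extrapolation term \<open>zbar - z\<close> after a step with update direction \<open>d\<close> and sample \<open>t\<close>.\<close>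

definition extrapolation :: "'b ^ 'n \<Rightarrow> 'n set \<Rightarrow> 'x" where
  "extrapolation d t = (\<Sum>i\<in>t. inverse (p i) *\<^sub>R adjoint (A i) (d $ i))"

definition spdhg_step :: "'x \<times> ('b ^ 'n) \<times> 'x \<times> 'x \<Rightarrow> 'n set \<Rightarrow> 'x \<times> ('b ^ 'n) \<times> 'x \<times> 'x" where
  "spdhg_step = (\<lambda>(x, y, z, zb) t.
     let d = y_full x y zb - y; z' = z + (\<Sum>i\<in>t. adjoint (A i) (d $ i))
     in (x_next x zb, y_next x y zb t, z', z' + extrapolation d t))"

definition spdhg_init :: "'x \<Rightarrow> 'b ^ 'n \<Rightarrow> 'x \<times> ('b ^ 'n) \<times> 'x \<times> 'x" where
  "spdhg_init x y = (x, y, A_adj y, A_adj y)"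

lemma spdhg_eq_iterate:
  "spdhg Y A g f \<tau> \<sigma> 1 p x0 y0 s k = iterate spdhg_step (spdhg_init x0 y0) s k"
proof (induction k)
  case 0
  then show ?case by (simp add: spdhg_init_def A_adj_def Let_def)
next
  case (Suc k)
  obtain x y z zb where st: "iterate spdhg_step (spdhg_init x0 y0) s k = (x, y, z, zb)"
    by (metis prod_cases4)
  show ?case
    unfolding spdhg.simps iterate.simps Suc st
    by (simp add: spdhg_step_def Let_def x_next_def y_full_def y_next_def prox_primal_def prox_dual_def
        extrapolation_def cong: sum.cong if_cong)
qed

text \<open>
  Since \<open>z\<close> stays equal to \<open>A\<^sup>* y\<close>, the difference \<open>zbar - z\<close> is the extrapolation term, and the
  state contains all that the Lyapunov function needs.
\<close>

definition spdhg_inv :: "'x \<times> ('b ^ 'n) \<times> 'x \<times> 'x \<Rightarrow> bool" where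
  "spdhg_inv = (\<lambda>(x, y, z, zb). y \<in> prod_space Y \<and> z = A_adj y)"

lemma y_full_mem: "y_full x y zb \<in> prod_space Y"
  by (simp add: y_full_def prod_space_def prox_dual)

lemma spdhg_inv_step:
  assumes "spdhg_inv st"
  shows "spdhg_inv (spdhg_step st t)"
proof -
  obtain x y z zb where st: "st = (x, y, z, zb)" by (metis prod_cases4)
  have y: "y \<in> prod_space Y" "z = A_adj y"
    using assms by (auto simp: st spdhg_inv_def)
  have "y_next x y zb t \<in> prod_space Y"
    using y(1) y_full_mem[of x y zb] by (auto simp: y_next_def prod_space_def)
  moreover have "A_adj y + (\<Sum>i\<in>t. adjoint (A i) ((y_full x y zb - y) $ i)) = A_adj (y_next x y zb t)"
  proof -
    have "adjoint (A i) (y_next x y zb t $ i)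
        = adjoint (A i) (y $ i) + (if i \<in> t then adjoint (A i) ((y_full x y zb - y) $ i) else 0)" for i
      using adjoint_A_add[of i "y $ i" "y_full x y zb $ i - y $ i"] by (simp add: y_next_def)
    then show ?thesis
      by (simp add: A_adj_def sum.distrib flip: sum.inter_restrict)
  qed
  ultimately show ?thesis
    by (simp add: st spdhg_inv_def spdhg_step_def Let_def y(2))
qed

subsection \<open>Averages over the sampling\<close>

lemma sum_law: "(\<Sum>t\<in>UNIV. law t) = 1"
  using integral_noise[of "\<lambda>_. 1 :: real"] by (simp add: prob_space)

lemma sum_law_inclusion: "(\<Sum>t\<in>UNIV. law t * (if i \<in> t then a else b)) = p i * a + (1 - p i) * b"
proof -
  have "(\<Sum>t\<in>UNIV. law t * (if i \<in> t then 1 else 0)) = (LINT \<omega>|M. (if i \<in> S 0 \<omega> then 1 else 0 :: real))"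
    using integral_noise[of "\<lambda>t. if i \<in> t then 1 else 0 :: real"] by simp
  also have "\<dots> = (LINT \<omega>|M. indicator {\<omega> \<in> space M. i \<in> S 0 \<omega>} \<omega>)"
    by (rule Bochner_Integration.integral_cong) (auto simp: indicator_def)
  also have "\<dots> = p i"
    unfolding inclusion_prob_def by (simp add: Int_def conj_commute)
  finally have p: "(\<Sum>t\<in>UNIV. law t * (if i \<in> t then 1 else 0)) = p i" .
  have "law t * (if i \<in> t then a else b) = (a - b) * (law t * (if i \<in> t then 1 else 0)) + b * law t" for t
    by (simp add: algebra_simps)
  then have "(\<Sum>t\<in>UNIV. law t * (if i \<in> t then a else b)) = (a - b) * p i + b"
    by (simp only: sum.distrib p sum_law flip: sum_distrib_left)
  then show ?thesis by (simp add: algebra_simps)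
qed

text \<open>The factors \<open>1 / p\<^sub>i\<close> make the extrapolation term an unbiased estimate of \<open>A\<^sup>* d\<close>.\<close>

lemma mean_extrapolation:
  "(\<Sum>t\<in>UNIV. law t * (extrapolation d t \<bullet> h)) = (\<Sum>i\<in>UNIV. A i h \<bullet> d $ i)"
proof -
  have "extrapolation d t \<bullet> h = (\<Sum>i\<in>UNIV. if i \<in> t then inverse (p i) * (A i h \<bullet> d $ i) else 0)" for t
    unfolding extrapolation_def inner_sum_left
    by (simp add: adjoint_A_inner sum.If_cases)
  then have "(\<Sum>t\<in>UNIV. law t * (extrapolation d t \<bullet> h))
      = (\<Sum>i\<in>UNIV. \<Sum>t\<in>UNIV. law t * (if i \<in> t then inverse (p i) * (A i h \<bullet> d $ i) else 0))"
    by (simp only: sum_distrib_left) (rule sum.swap)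
  also have "\<dots> = (\<Sum>i\<in>UNIV. A i h \<bullet> d $ i)"
    unfolding sum_law_inclusion
    by (intro sum.cong refl) (simp add: sampling_proper[THEN less_imp_neq, THEN not_sym] field_simps)
  finally show ?thesis .
qed

subsection \<open>The step size operator\<close>

lemma bounded_linear_C_op: "bounded_linear (C_op A \<tau> \<sigma> i)"
  unfolding C_op_def[abs_def] by (rule bounded_linear_const_scaleR[OF A(1)])

lemma adjoint_C_op: "adjoint (C_op A \<tau> \<sigma> i) v = (sqrt \<tau> * sqrt (\<sigma> i)) *\<^sub>R adjoint (A i) v"
proof -
  have "adjoint (C_op A \<tau> \<sigma> i) = (\<lambda>v. (sqrt \<tau> * sqrt (\<sigma> i)) *\<^sub>R adjoint (A i) v)"
    by (rule adjoint_unique) (simp add: C_op_def hilbert_adjoint_works[OF A(1)])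
  then show ?thesis by simp
qed

lemma C_set_adjoint: "w \<bullet> C_set A \<tau> \<sigma> t u = C_set_adj A \<tau> \<sigma> t w \<bullet> u"
proof -
  have "w \<bullet> C_set A \<tau> \<sigma> t u = (\<Sum>i\<in>UNIV. if i \<in> t then C_op A \<tau> \<sigma> i u \<bullet> w $ i else 0)"
    unfolding inner_vec_def by (intro sum.cong) (auto simp: C_set_def inner_commute)
  also have "\<dots> = (\<Sum>i\<in>t. u \<bullet> adjoint (C_op A \<tau> \<sigma> i) (w $ i))"
    by (simp add: sum.If_cases hilbert_adjoint_works[OF bounded_linear_C_op])
  also have "\<dots> = u \<bullet> C_set_adj A \<tau> \<sigma> t w"
    by (simp add: C_set_adj_def inner_sum_right)
  finally show ?thesis by (simp only: inner_commute)
qed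

lemma Q_op_adjoint: "w \<bullet> Q_op q v = Q_op q w \<bullet> v" for w v :: "'b ^ 'n"
  by (simp add: Q_op_def inner_vec_def)

lemma step_op_eq:
  "step_op M (S 0) A \<tau> \<sigma> y = Q_op p (\<Sum>t\<in>UNIV. law t *\<^sub>R C_set A \<tau> \<sigma> t (C_set_adj A \<tau> \<sigma> t (Q_op p y)))"
  unfolding step_op_def Let_def by (subst integral_noise) (rule refl)

lemma bounded_linear_step_op: "bounded_linear (step_op M (S 0) A \<tau> \<sigma>)"
proof -
  have Q: "bounded_linear (Q_op p :: 'b ^ 'n \<Rightarrow> 'b ^ 'n)"
    by (rule bounded_linear_vecI)
      (simp add: Q_op_def bounded_linear_const_scaleR[OF bounded_linear_vec_nth])
  have C: "bounded_linear (C_set A \<tau> \<sigma> t)" for t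
  proof (rule bounded_linear_vecI)
    show "bounded_linear (\<lambda>u. C_set A \<tau> \<sigma> t u $ i)" for i
      by (cases "i \<in> t") (simp_all add: C_set_def bounded_linear_C_op)
  qed
  have C': "bounded_linear (C_set_adj A \<tau> \<sigma> t)" for t
    unfolding C_set_adj_def[abs_def]
    by (intro bounded_linear_sum bounded_linear_compose[OF hilbert_adjoint_bounded_linear[OF bounded_linear_C_op]]
        bounded_linear_vec_nth)
  show ?thesis
    unfolding step_op_eq[abs_def]
    by (intro bounded_linear_compose[OF Q] bounded_linear_sum bounded_linear_const_scaleR
        bounded_linear_compose[OF C] bounded_linear_compose[OF C'] Q)
qed

abbreviation D_norm :: real where
  "D_norm \<equiv> onorm_on (prod_space Y) (step_op M (S 0) A \<tau> \<sigma>)"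

text \<open>
  The step size condition bounds the extrapolation term only in the mean over the samples:
  \<open>y \<bullet> D y\<close> is the second moment of \<open>C_S\<^sup>* Q y\<close>, which for \<open>y\<^sub>i = d\<^sub>i / sqrt \<sigma>\<^sub>i\<close> is, up to the factor
  \<open>\<tau>\<close>, that of the extrapolation term.
\<close>

lemma mean_extrapolation_norm_le:
  assumes d: "d \<in> prod_space Y"
  shows "\<tau> * (\<Sum>t\<in>UNIV. law t * (norm (extrapolation d t))\<^sup>2) \<le> D_norm * (\<Sum>i\<in>UNIV. (norm (d $ i))\<^sup>2 / \<sigma> i)"
proof -
  define y :: "'b ^ 'n" where "y = (\<chi> i. (1 / sqrt (\<sigma> i)) *\<^sub>R d $ i)"
  have y: "y \<in> prod_space Y"
    using d Y(1) by (auto simp: y_def prod_space_def subspace_scale)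
  have "adjoint (C_op A \<tau> \<sigma> i) (Q_op p y $ i) = sqrt \<tau> *\<^sub>R (inverse (p i) *\<^sub>R adjoint (A i) (d $ i))" for i
  proof -
    have "adjoint (A i) (Q_op p y $ i) = inverse (p i) *\<^sub>R (1 / sqrt (\<sigma> i)) *\<^sub>R adjoint (A i) (d $ i)"
      using bounded_linear.linear[OF hilbert_adjoint_bounded_linear[OF A(1)]]
      by (simp add: Q_op_def y_def linear_scale)
    then show ?thesis
      unfolding adjoint_C_op using steps(2)[of i] by (simp add: mult.commute)
  qed
  then have ext: "C_set_adj A \<tau> \<sigma> t (Q_op p y) = sqrt \<tau> *\<^sub>R extrapolation d t" for t
    by (simp add: C_set_adj_def extrapolation_def scaleR_sum_right)
  have "y \<bullet> step_op M (S 0) A \<tau> \<sigma> y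
      = (\<Sum>t\<in>UNIV. law t * (Q_op p y \<bullet> C_set A \<tau> \<sigma> t (C_set_adj A \<tau> \<sigma> t (Q_op p y))))"
    unfolding step_op_eq Q_op_adjoint by (simp add: inner_sum_right)
  also have "\<dots> = (\<Sum>t\<in>UNIV. law t * (norm (C_set_adj A \<tau> \<sigma> t (Q_op p y)))\<^sup>2)"
    by (simp add: C_set_adjoint power2_norm_eq_inner)
  also have "\<dots> = \<tau> * (\<Sum>t\<in>UNIV. law t * (norm (extrapolation d t))\<^sup>2)"
    using steps(1) by (simp add: ext power_mult_distrib sum_distrib_left mult.left_commute)
  finally have "\<tau> * (\<Sum>t\<in>UNIV. law t * (norm (extrapolation d t))\<^sup>2) = y \<bullet> step_op M (S 0) A \<tau> \<sigma> y" ..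
  also have "\<dots> \<le> norm y * (D_norm * norm y)"
    by (rule order_trans[OF norm_cauchy_schwarz])
      (intro mult_left_mono onorm_on_bound[OF bounded_linear_step_op y] norm_ge_zero)
  also have "\<dots> = D_norm * (norm y)\<^sup>2"
    by (simp add: power2_eq_square)
  also have "(norm y)\<^sup>2 = (\<Sum>i\<in>UNIV. (norm (d $ i))\<^sup>2 / \<sigma> i)"
    unfolding power2_norm_vec y_def using steps(2)
    by (intro sum.cong) (auto simp: power_divide less_imp_le)
  finally show ?thesis .
qed

subsection \<open>The Lyapunov function\<close>

text \<open>
  The Lyapunov function requires \<open>\<gamma> < 1\<close> and \<open>\<parallel>D\<parallel> \<le> \<gamma>\<^sup>2\<close>. The arithmetic mean of \<open>1\<close> and \<open>\<parallel>D\<parallel>\<close> has the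
  second property because it dominates the geometric mean.
\<close>

definition \<gamma> :: real where "\<gamma> = (1 + D_norm) / 2"

lemma gamma: "0 < \<gamma>" "\<gamma> < 1" "D_norm \<le> \<gamma> * \<gamma>"
proof -
  have "0 \<in> prod_space Y"
    by (simp add: prod_space_def subspace_0[OF Y(1)])
  then have "0 \<le> D_norm"
    by (rule onorm_on_nonneg[OF bounded_linear_step_op])
  then show "0 < \<gamma>" "\<gamma> < 1"
    using D by (auto simp: \<gamma>_def)
  have "0 \<le> (1 - D_norm)\<^sup>2" by simp
  then show "D_norm \<le> \<gamma> * \<gamma>"
    by (simp add: \<gamma>_def power2_eq_square field_simps)
qed

definition weighted_dist2 :: "'x \<times> ('b ^ 'n) \<Rightarrow> 'x \<times> ('b ^ 'n) \<Rightarrow> real" where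
  "weighted_dist2 = (\<lambda>(x, y) (x', y'). (norm (x - x'))\<^sup>2 / (2 * \<tau>)
     + (\<Sum>i\<in>UNIV. (norm (y $ i - y' $ i))\<^sup>2 / (2 * \<sigma> i * p i)))"

text \<open>
  In the two functions below, \<open>zb - z\<close> is the extrapolation term of the previous step. The decrease is
  measured with the full dual update and is therefore determined before the next sample is drawn.
\<close>

definition lyapunov :: "'x \<times> ('b ^ 'n) \<Rightarrow> 'x \<times> ('b ^ 'n) \<times> 'x \<times> 'x \<Rightarrow> real" where
  "lyapunov w = (\<lambda>(x, y, z, zb). weighted_dist2 (x, y) w
     - (zb - z) \<bullet> (x - fst w) + \<tau> / (2 * \<gamma>) * (norm (zb - z))\<^sup>2)"

definition decrease :: "'x \<times> ('b ^ 'n) \<times> 'x \<times> 'x \<Rightarrow> real" where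
  "decrease = (\<lambda>(x, y, z, zb). (1 - \<gamma>) * ((norm (x_next x zb - x))\<^sup>2 / (2 * \<tau>)
     + (\<Sum>i\<in>UNIV. (norm (y_full x y zb $ i - y $ i))\<^sup>2 / (2 * \<sigma> i))))"

lemma young: "\<bar>m \<bullet> v\<bar> \<le> \<gamma> * ((norm v)\<^sup>2 / (2 * \<tau>)) + \<tau> / (2 * \<gamma>) * (norm m)\<^sup>2" for m v :: 'x
proof -
  have "0 \<le> (\<gamma> * norm v - \<tau> * norm m)\<^sup>2 / (2 * \<gamma> * \<tau>)"
    using gamma(1) steps(1) by simp
  also have "\<dots> = \<gamma> * ((norm v)\<^sup>2 / (2 * \<tau>)) + \<tau> / (2 * \<gamma>) * (norm m)\<^sup>2 - norm m * norm v"
    using gamma(1) steps(1) by (simp add: power2_eq_square field_simps)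
  finally show ?thesis
    using Cauchy_Schwarz_ineq2[of m v] by simp
qed

text \<open>
  The last term of the Lyapunov function and a part \<open>\<gamma>\<close> of the primal distance absorb the mixed term.
  The bound holds for every state, not only in the mean.
\<close>

lemma lyapunov_ge:
  "(1 - \<gamma>) * ((norm (x - fst w))\<^sup>2 / (2 * \<tau>)) + (\<Sum>i\<in>UNIV. (norm (y $ i - snd w $ i))\<^sup>2 / (2 * \<sigma> i * p i))
     \<le> lyapunov w (x, y, z, zb)"
proof -
  have "(1 - \<gamma>) * ((norm (x - fst w))\<^sup>2 / (2 * \<tau>))
      = (norm (x - fst w))\<^sup>2 / (2 * \<tau>) - \<gamma> * ((norm (x - fst w))\<^sup>2 / (2 * \<tau>))"
    by (simp only: left_diff_distrib mult_1_left)
  moreover have "lyapunov w (x, y, z, zb) = (norm (x - fst w))\<^sup>2 / (2 * \<tau>)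
      + (\<Sum>i\<in>UNIV. (norm (y $ i - snd w $ i))\<^sup>2 / (2 * \<sigma> i * p i))
      - (zb - z) \<bullet> (x - fst w) + \<tau> / (2 * \<gamma>) * (norm (zb - z))\<^sup>2"
    by (simp add: lyapunov_def weighted_dist2_def split_beta)
  ultimately show ?thesis
    using young[of "zb - z" "x - fst w"] by linarith
qed

lemma weights_pos: "0 < \<sigma> i" "0 < p i" "0 \<le> \<sigma> i" "0 \<le> p i"
  using steps(2)[of i] sampling_proper[of i] by auto

lemma lyapunov_nonneg: "0 \<le> lyapunov w st"
proof -
  obtain x y z zb where st: "st = (x, y, z, zb)" by (metis prod_cases4)
  have "0 \<le> (1 - \<gamma>) * ((norm (x - fst w))\<^sup>2 / (2 * \<tau>)) + (\<Sum>i\<in>UNIV. (norm (y $ i - snd w $ i))\<^sup>2 / (2 * \<sigma> i * p i))"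
    using gamma(2) steps(1) weights_pos by (intro add_nonneg_nonneg mult_nonneg_nonneg sum_nonneg) auto
  then show ?thesis using lyapunov_ge[of x w y z zb] st by simp
qed

lemma decrease_nonneg: "0 \<le> decrease st"
  using gamma(2) steps(1) weights_pos
  by (auto simp: decrease_def split_beta intro!: mult_nonneg_nonneg add_nonneg_nonneg sum_nonneg)

text \<open>
  Adding the optimality conditions of the two proximal steps and the saddle point inequalities
  eliminates all function values.
\<close>

lemma prox_steps_saddle_inequality:
  fixes x z zb xs :: 'x and y ys :: "'b ^ 'n"
  assumes w: "saddle_point Y A g f (xs, ys)"
    and z: "z = A_adj y"
  defines "x' \<equiv> x_next x zb" and "y' \<equiv> y_full x y zb"
  shows "(1 / \<tau>) * ((x - x') \<bullet> (xs - x')) + (\<Sum>i\<in>UNIV. (1 / \<sigma> i) * ((y $ i - y' $ i) \<bullet> (ys $ i - y' $ i)))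
     + (zb - z) \<bullet> (x' - xs) - (\<Sum>i\<in>UNIV. A i (x' - xs) \<bullet> (y' - y) $ i) \<le> 0"
proof -
  have w': "ys \<in> prod_space Y" "g xs < \<infinity>" "\<And>i. fc i (ys $ i) < \<infinity>"
    using w by (auto simp: saddle_point_iff)
  have "G x' + (1 / \<tau>) * ((x - \<tau> *\<^sub>R zb - x') \<bullet> (xs - x')) \<le> G xs"
    unfolding x'_def x_next_def by (rule prox_primal(2)[OF w'(2)])
  moreover have "(1 / \<tau>) * ((x - \<tau> *\<^sub>R zb - x') \<bullet> (xs - x')) = (1 / \<tau>) * ((x - x') \<bullet> (xs - x')) + zb \<bullet> (x' - xs)"
  proof -
    have "(x - \<tau> *\<^sub>R zb - x') \<bullet> v = (x - x') \<bullet> v - \<tau> * (zb \<bullet> v)" for v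
      by (simp add: inner_diff_left)
    then show ?thesis
      using steps(1) by (simp add: right_diff_distrib inner_diff_right[of zb])
  qed
  moreover have "A_adj ys \<bullet> xs + G xs \<le> A_adj ys \<bullet> x' + G x'"
    using w prox_primal(1) by (auto simp: saddle_point_iff x'_def x_next_def)
  ultimately have primal: "(1 / \<tau>) * ((x - x') \<bullet> (xs - x')) + zb \<bullet> (x' - xs) \<le> A_adj ys \<bullet> (x' - xs)"
    by (simp add: inner_diff_right)
  have y': "y' $ i = prox_dual i (y $ i + \<sigma> i *\<^sub>R A i x')" for i
    by (simp add: y'_def y_full_def x'_def)
  have opt: "F i (y' $ i) + (1 / \<sigma> i) * ((y $ i + \<sigma> i *\<^sub>R A i x' - y' $ i) \<bullet> (ys $ i - y' $ i)) \<le> F i (ys $ i)" for i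
    unfolding y' using w' by (intro prox_dual(3)) (auto simp: prod_space_def)
  have "(1 / \<sigma> i) * ((y $ i - y' $ i) \<bullet> (ys $ i - y' $ i))
      \<le> F i (ys $ i) - F i (y' $ i) - A i x' \<bullet> (ys $ i - y' $ i)" for i
  proof -
    have "(y $ i + \<sigma> i *\<^sub>R A i x' - y' $ i) \<bullet> v = (y $ i - y' $ i) \<bullet> v + \<sigma> i * (A i x' \<bullet> v)" for v
      by (simp add: inner_diff_left inner_add_left)
    then have "(1 / \<sigma> i) * ((y $ i + \<sigma> i *\<^sub>R A i x' - y' $ i) \<bullet> (ys $ i - y' $ i))
        = (1 / \<sigma> i) * ((y $ i - y' $ i) \<bullet> (ys $ i - y' $ i)) + A i x' \<bullet> (ys $ i - y' $ i)"
      using steps(2)[of i] by (simp add: distrib_left)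
    then show ?thesis using opt[of i] by linarith
  qed
  then have "(\<Sum>i\<in>UNIV. (1 / \<sigma> i) * ((y $ i - y' $ i) \<bullet> (ys $ i - y' $ i)))
      \<le> (\<Sum>i\<in>UNIV. F i (ys $ i) - F i (y' $ i) - A i x' \<bullet> (ys $ i - y' $ i))"
    by (rule sum_mono)
  moreover have "(\<Sum>i\<in>UNIV. A i xs \<bullet> y' $ i - F i (y' $ i)) \<le> (\<Sum>i\<in>UNIV. A i xs \<bullet> ys $ i - F i (ys $ i))"
    using w y_full_mem[of x y zb] prox_dual(2) by (auto simp: saddle_point_iff y' simp flip: y'_def)
  ultimately have dual: "(\<Sum>i\<in>UNIV. (1 / \<sigma> i) * ((y $ i - y' $ i) \<bullet> (ys $ i - y' $ i)))
      \<le> (\<Sum>i\<in>UNIV. A i (x' - xs) \<bullet> (y' $ i - ys $ i))"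
    by (simp add: A_diff sum_subtractf inner_diff_left inner_diff_right)
  have "z \<bullet> (x' - xs) = (\<Sum>i\<in>UNIV. A i (x' - xs) \<bullet> y $ i)" "A_adj ys \<bullet> (x' - xs) = (\<Sum>i\<in>UNIV. A i (x' - xs) \<bullet> ys $ i)"
    unfolding z by (rule A_adj_inner)+
  with primal dual show ?thesis
    by (simp add: inner_diff_left inner_diff_right[of "A _ _"] sum_subtractf)
qed

text \<open>
  Block \<open>i\<close> is updated with probability \<open>p\<^sub>i\<close>, and the weight \<open>1 / p\<^sub>i\<close> turns the mean change of its
  distance into the change under the full update.
\<close>

lemma mean_weighted_dist2:
  "(\<Sum>t\<in>UNIV. law t * weighted_dist2 (x', y_next x y zb t) (xs, ys))
     = (norm (x' - xs))\<^sup>2 / (2 * \<tau>) + (\<Sum>i\<in>UNIV. ((norm (y_full x y zb $ i - ys $ i))\<^sup>2 - (norm (y $ i - ys $ i))\<^sup>2) / (2 * \<sigma> i))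
       + (\<Sum>i\<in>UNIV. (norm (y $ i - ys $ i))\<^sup>2 / (2 * \<sigma> i * p i))"
proof -
  let ?N = "\<lambda>i. (norm (y_full x y zb $ i - ys $ i))\<^sup>2" and ?O = "\<lambda>i. (norm (y $ i - ys $ i))\<^sup>2"
  have "(norm (y_next x y zb t $ i - ys $ i))\<^sup>2 / (2 * \<sigma> i * p i)
      = (if i \<in> t then ?N i / (2 * \<sigma> i * p i) else ?O i / (2 * \<sigma> i * p i))" for t i
    by (simp add: y_next_def)
  then have "(\<Sum>t\<in>UNIV. law t * weighted_dist2 (x', y_next x y zb t) (xs, ys))
      = (\<Sum>t\<in>UNIV. law t * ((norm (x' - xs))\<^sup>2 / (2 * \<tau>))) + (\<Sum>t\<in>UNIV. \<Sum>i\<in>UNIV. law t *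
          (if i \<in> t then ?N i / (2 * \<sigma> i * p i) else ?O i / (2 * \<sigma> i * p i)))"
    unfolding weighted_dist2_def by (simp only: prod.case distrib_left sum.distrib sum_distrib_left)
  also have "(\<Sum>t\<in>UNIV. law t * ((norm (x' - xs))\<^sup>2 / (2 * \<tau>))) = (norm (x' - xs))\<^sup>2 / (2 * \<tau>)"
    by (simp only: sum_law mult_1_left flip: sum_distrib_right)
  also have "(\<Sum>t\<in>UNIV. \<Sum>i\<in>UNIV. law t * (if i \<in> t then ?N i / (2 * \<sigma> i * p i) else ?O i / (2 * \<sigma> i * p i)))
      = (\<Sum>i\<in>UNIV. p i * (?N i / (2 * \<sigma> i * p i)) + (1 - p i) * (?O i / (2 * \<sigma> i * p i)))"
    by (subst sum.swap) (simp only: sum_law_inclusion)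
  also have "\<dots> = (\<Sum>i\<in>UNIV. (?N i - ?O i) / (2 * \<sigma> i) + ?O i / (2 * \<sigma> i * p i))"
    using weights_pos by (intro sum.cong) (auto simp: field_simps less_imp_neq[symmetric])
  finally show ?thesis by (simp add: sum.distrib)
qed

text \<open>
  Polarisation turns the inner products in \<open>prox_steps_saddle_inequality\<close> into differences of squared
  distances. The term \<open>(zb - z) \<bullet> (x' - xs)\<close> splits into the mixed term of the current state and a
  remainder along the primal step, which Young's inequality bounds. The term with \<open>y' - y\<close> is the mean
  of the mixed term after the step.
\<close>

lemma lyapunov_step:
  assumes w: "saddle_point Y A g f w" and inv: "spdhg_inv st"
  shows "(\<Sum>t\<in>UNIV. law t * lyapunov w (spdhg_step st t)) \<le> lyapunov w st - decrease st"
proof -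
  obtain xs ys where ws: "w = (xs, ys)" by (cases w)
  obtain x y z zb where st: "st = (x, y, z, zb)" by (metis prod_cases4)
  have y: "y \<in> prod_space Y" "z = A_adj y"
    using inv by (auto simp: st spdhg_inv_def)
  define x' where "x' = x_next x zb"
  define y' where "y' = y_full x y zb"
  define m where "m = zb - z"
  define c where "c = (\<Sum>i\<in>UNIV. A i (x' - xs) \<bullet> (y' - y) $ i)"
  define \<mu> where "\<mu> = (\<Sum>t\<in>UNIV. law t * (norm (extrapolation (y' - y) t))\<^sup>2)"
  define dx where "dx = (norm (x' - x))\<^sup>2 / (2 * \<tau>)"
  define dy where "dy = (\<Sum>i\<in>UNIV. (norm (y' $ i - y $ i))\<^sup>2 / (2 * \<sigma> i))"
  define n where "n = (\<Sum>i\<in>UNIV. ((norm (y' $ i - ys $ i))\<^sup>2 - (norm (y $ i - ys $ i))\<^sup>2) / (2 * \<sigma> i))"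
  define q where "q = (\<Sum>i\<in>UNIV. (norm (y $ i - ys $ i))\<^sup>2 / (2 * \<sigma> i * p i))"
  have "lyapunov w (spdhg_step st t) = weighted_dist2 (x', y_next x y zb t) (xs, ys)
      - extrapolation (y' - y) t \<bullet> (x' - xs) + \<tau> / (2 * \<gamma>) * (norm (extrapolation (y' - y) t))\<^sup>2" for t
    by (simp add: lyapunov_def spdhg_step_def st ws Let_def x'_def y'_def)
  then have "(\<Sum>t\<in>UNIV. law t * lyapunov w (spdhg_step st t))
      = (\<Sum>t\<in>UNIV. law t * weighted_dist2 (x', y_next x y zb t) (xs, ys))
        - (\<Sum>t\<in>UNIV. law t * (extrapolation (y' - y) t \<bullet> (x' - xs))) + \<tau> / (2 * \<gamma>) * \<mu>"
    by (simp add: distrib_left right_diff_distrib sum.distrib sum_subtractf \<mu>_def sum_distrib_left mult.left_commute)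
  also have "\<dots> = (norm (x' - xs))\<^sup>2 / (2 * \<tau>) + n + q - c + \<tau> / (2 * \<gamma>) * \<mu>"
    unfolding mean_weighted_dist2 mean_extrapolation n_def q_def c_def y'_def by simp
  finally have mean: "(\<Sum>t\<in>UNIV. law t * lyapunov w (spdhg_step st t))
      = (norm (x' - xs))\<^sup>2 / (2 * \<tau>) + n + q - c + \<tau> / (2 * \<gamma>) * \<mu>" .
  have noise: "\<tau> / (2 * \<gamma>) * \<mu> \<le> \<gamma> * dy"
  proof -
    have "y' - y \<in> prod_space Y"
      using y(1) y_full_mem[of x y zb] Y(1) by (auto simp: y'_def prod_space_def subspace_diff)
    then have "\<tau> * \<mu> \<le> D_norm * (\<Sum>i\<in>UNIV. (norm ((y' - y) $ i))\<^sup>2 / \<sigma> i)"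
      unfolding \<mu>_def by (rule mean_extrapolation_norm_le)
    also have "(\<Sum>i\<in>UNIV. (norm ((y' - y) $ i))\<^sup>2 / \<sigma> i) = 2 * dy"
      by (simp add: dy_def sum_distrib_left)
    also have "D_norm * (2 * dy) \<le> (\<gamma> * \<gamma>) * (2 * dy)"
      using gamma(3) weights_pos by (intro mult_right_mono) (auto simp: dy_def intro!: sum_nonneg)
    finally show ?thesis using gamma(1) by (simp add: field_simps)
  qed
  have "(1 / \<tau>) * ((x - x') \<bullet> (xs - x')) = dx + (norm (x' - xs))\<^sup>2 / (2 * \<tau>) - (norm (x - xs))\<^sup>2 / (2 * \<tau>)"
    unfolding inner_polarization dx_def using steps(1) by (simp add: field_simps)
  moreover have "(\<Sum>i\<in>UNIV. (1 / \<sigma> i) * ((y $ i - y' $ i) \<bullet> (ys $ i - y' $ i))) = dy + n"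
    unfolding inner_polarization dy_def n_def sum.distrib[symmetric] using weights_pos
    by (intro sum.cong) (auto simp: field_simps less_imp_neq[symmetric])
  ultimately have "dx + (norm (x' - xs))\<^sup>2 / (2 * \<tau>) - (norm (x - xs))\<^sup>2 / (2 * \<tau>) + (dy + n) + m \<bullet> (x' - xs) - c \<le> 0"
    using prox_steps_saddle_inequality[OF w[unfolded ws] y(2), of x zb]
    by (simp only: x'_def y'_def m_def c_def)
  moreover have "m \<bullet> (x' - xs) = m \<bullet> (x' - x) + m \<bullet> (x - xs)"
    by (simp add: inner_diff_right)
  moreover have "- (\<gamma> * dx + \<tau> / (2 * \<gamma>) * (norm m)\<^sup>2) \<le> m \<bullet> (x' - x)"
    using young[of m "x' - x"] unfolding dx_def by linarith
  moreover have "lyapunov w st = (norm (x - xs))\<^sup>2 / (2 * \<tau>) + q - m \<bullet> (x - xs) + \<tau> / (2 * \<gamma>) * (norm m)\<^sup>2"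
    by (simp add: lyapunov_def st ws weighted_dist2_def q_def m_def)
  moreover have "decrease st = (1 - \<gamma>) * (dx + dy)"
    by (simp add: decrease_def st dx_def dy_def x'_def y'_def)
  then have "decrease st = dx + dy - \<gamma> * dx - \<gamma> * dy"
    by (simp add: algebra_simps)
  ultimately show ?thesis using mean noise by linarith
qed

end

section \<open>Convergence along one realisation of the sampling\<close>

lemma tendsto_zero_if_power2_norm_le:
  fixes v :: "nat \<Rightarrow> 'a::real_normed_vector"
  assumes r: "r \<longlonglongrightarrow> (0::real)" and le: "\<And>k. (norm (v k))\<^sup>2 \<le> K * r k"
  shows "v \<longlonglongrightarrow> 0"
proof -
  have "(\<lambda>k. (norm (v k))\<^sup>2) \<longlonglongrightarrow> 0"
  proof (rule tendsto_sandwich[of "\<lambda>_. 0" _ _ "\<lambda>k. K * r k"])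
    show "(\<lambda>k. K * r k) \<longlonglongrightarrow> 0"
      using tendsto_mult_right_zero[OF r] .
  qed (use le in auto)
  then have "(\<lambda>k. sqrt ((norm (v k))\<^sup>2)) \<longlonglongrightarrow> sqrt 0"
    by (rule tendsto_real_sqrt)
  then show ?thesis by (simp add: tendsto_norm_zero_iff)
qed

lemma tendsto_inner_null_bounded:
  fixes m v :: "nat \<Rightarrow> 'a::real_inner"
  assumes m: "m \<longlonglongrightarrow> 0" and v: "\<And>k. norm (v k) \<le> K"
  shows "(\<lambda>k. m k \<bullet> v k) \<longlonglongrightarrow> 0"
proof (rule Lim_null_comparison)
  show "(\<lambda>k. norm (m k) * K) \<longlonglongrightarrow> 0"
    using tendsto_mult_left_zero[OF tendsto_norm_zero[OF m]] .
  show "\<forall>\<^sub>F k in sequentially. norm (m k \<bullet> v k) \<le> norm (m k) * K"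
    using v by (intro always_eventually allI)
      (metis Cauchy_Schwarz_ineq2 mult_left_mono norm_ge_zero order_trans real_norm_def)
qed

text \<open>
  Here the samples \<open>e\<close> are fixed; the probability space enters only through the constants \<open>p\<close> and
  \<open>\<parallel>D\<parallel>\<close>.
\<close>

locale spdhg_path = spdhg_problem M S Y A g f \<tau> \<sigma>
  for M :: "'w measure" and S :: "nat \<Rightarrow> 'w \<Rightarrow> 'n::finite set"
    and Y :: "'n \<Rightarrow> 'b::{real_inner, complete_space, second_countable_topology} set"
    and A :: "'n \<Rightarrow> 'x::{real_inner, complete_space, second_countable_topology} \<Rightarrow> 'b"
    and g :: "'x \<Rightarrow> ereal" and f :: "'n \<Rightarrow> 'b \<Rightarrow> ereal"
    and \<tau> :: real and \<sigma> :: "'n \<Rightarrow> real" +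
  fixes e :: "nat \<Rightarrow> 'n set" and x0 :: 'x and y0 :: "'b ^ 'n"
  assumes y0: "y0 \<in> prod_space Y"
    and summable_decrease: "summable (\<lambda>k. decrease (iterate spdhg_step (spdhg_init x0 y0) e k))"
begin

abbreviation state :: "nat \<Rightarrow> 'x \<times> ('b ^ 'n) \<times> 'x \<times> 'x" where
  "state \<equiv> iterate spdhg_step (spdhg_init x0 y0) e"

definition x :: "nat \<Rightarrow> 'x" where "x k = fst (state k)"
definition y :: "nat \<Rightarrow> 'b ^ 'n" where "y k = fst (snd (state k))"
definition z :: "nat \<Rightarrow> 'x" where "z k = fst (snd (snd (state k)))"
definition zb :: "nat \<Rightarrow> 'x" where "zb k = snd (snd (snd (state k)))"
definition y' :: "nat \<Rightarrow> 'b ^ 'n" where "y' k = y_full (x k) (y k) (zb k)"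

lemma state_eq: "state k = (x k, y k, z k, zb k)"
  by (simp add: x_def y_def z_def zb_def)

lemma x_Suc: "x (Suc k) = x_next (x k) (zb k)"
  and extrapolation_Suc: "zb (Suc k) - z (Suc k) = extrapolation (y' k - y k) (e k)"
proof -
  have "state (Suc k) = spdhg_step (x k, y k, z k, zb k) (e k)"
    by (simp add: state_eq)
  then show "x (Suc k) = x_next (x k) (zb k)"
    and "zb (Suc k) - z (Suc k) = extrapolation (y' k - y k) (e k)"
    unfolding state_eq[of "Suc k"] by (simp_all add: spdhg_step_def Let_def y'_def)
qed

lemma y_mem: "y k \<in> prod_space Y" and z_eq: "z k = A_adj (y k)"
proof -
  have "spdhg_inv (spdhg_init x0 y0)"
    by (simp add: spdhg_inv_def spdhg_init_def y0)
  then have "spdhg_inv (state k)"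
    by (induction k) (auto intro: spdhg_inv_step)
  then show "y k \<in> prod_space Y" "z k = A_adj (y k)"
    by (simp_all add: state_eq spdhg_inv_def)
qed

lemma decrease_tendsto: "(\<lambda>k. decrease (state k)) \<longlonglongrightarrow> 0"
  using summable_decrease by (rule summable_LIMSEQ_zero)

lemma decrease_eq: "decrease (state k) = (1 - \<gamma>) * ((norm (x (Suc k) - x k))\<^sup>2 / (2 * \<tau>)
     + (\<Sum>i\<in>UNIV. (norm (y' k $ i - y k $ i))\<^sup>2 / (2 * \<sigma> i)))"
  unfolding state_eq decrease_def by (simp add: x_Suc y'_def)

lemma x_diff_tendsto: "(\<lambda>k. x (Suc k) - x k) \<longlonglongrightarrow> 0"
proof (rule tendsto_zero_if_power2_norm_le[OF decrease_tendsto])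
  fix k
  have "(1 - \<gamma>) * ((norm (x (Suc k) - x k))\<^sup>2 / (2 * \<tau>)) \<le> decrease (state k)"
    unfolding decrease_eq using gamma(2) weights_pos
    by (intro mult_left_mono) (auto intro!: sum_nonneg)
  then show "(norm (x (Suc k) - x k))\<^sup>2 \<le> (2 * \<tau> / (1 - \<gamma>)) * decrease (state k)"
    using gamma(2) steps(1) by (simp add: field_simps)
qed

lemma y_diff_tendsto: "(\<lambda>k. y' k $ i - y k $ i) \<longlonglongrightarrow> 0"
proof (rule tendsto_zero_if_power2_norm_le[OF decrease_tendsto])
  fix k
  have "(norm (y' k $ i - y k $ i))\<^sup>2 / (2 * \<sigma> i) \<le> (\<Sum>i\<in>UNIV. (norm (y' k $ i - y k $ i))\<^sup>2 / (2 * \<sigma> i))"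
    by (rule member_le_sum) (use weights_pos in auto)
  also have "\<dots> \<le> (norm (x (Suc k) - x k))\<^sup>2 / (2 * \<tau>) + \<dots>"
    using steps(1) by simp
  finally have "(1 - \<gamma>) * ((norm (y' k $ i - y k $ i))\<^sup>2 / (2 * \<sigma> i)) \<le> decrease (state k)"
    unfolding decrease_eq using gamma(2) by (intro mult_left_mono) auto
  then show "(norm (y' k $ i - y k $ i))\<^sup>2 \<le> (2 * \<sigma> i / (1 - \<gamma>)) * decrease (state k)"
    using gamma(2) weights_pos[of i] by (simp add: field_simps)
qed

lemma extrapolation_tendsto: "(\<lambda>k. zb k - z k) \<longlonglongrightarrow> 0"
proof -
  let ?a = "\<lambda>i k. inverse (p i) *\<^sub>R adjoint (A i) (y' k $ i - y k $ i)"
  have "(\<lambda>k. adjoint (A i) (y' k $ i - y k $ i)) \<longlonglongrightarrow> adjoint (A i) 0" for i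
    by (rule bounded_linear.tendsto[OF hilbert_adjoint_bounded_linear[OF A(1)] y_diff_tendsto])
  then have "?a i \<longlonglongrightarrow> inverse (p i) *\<^sub>R adjoint (A i) 0" for i
    by (intro tendsto_scaleR tendsto_const)
  then have "?a i \<longlonglongrightarrow> 0" for i
    by (simp add: linear_0[OF bounded_linear.linear[OF hilbert_adjoint_bounded_linear[OF A(1)]]])
  then have "(\<lambda>k. \<Sum>i\<in>UNIV. norm (?a i k)) \<longlonglongrightarrow> (\<Sum>i\<in>(UNIV :: 'n set). 0)"
    by (intro tendsto_sum tendsto_norm_zero)
  then have sum0: "(\<lambda>k. \<Sum>i\<in>UNIV. norm (?a i k)) \<longlonglongrightarrow> 0" by simp
  have "norm (zb (Suc k) - z (Suc k)) \<le> (\<Sum>i\<in>UNIV. norm (?a i k))" for k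
  proof -
    have "norm (zb (Suc k) - z (Suc k)) \<le> (\<Sum>i\<in>e k. norm (?a i k))"
      unfolding extrapolation_Suc extrapolation_def vector_minus_component by (rule norm_sum)
    also have "\<dots> \<le> (\<Sum>i\<in>UNIV. norm (?a i k))"
      by (intro sum_mono2) auto
    finally show ?thesis .
  qed
  then have "(\<lambda>k. zb (Suc k) - z (Suc k)) \<longlonglongrightarrow> 0"
    by (intro Lim_null_comparison[OF _ sum0] always_eventually allI)
  then show ?thesis by (rule LIMSEQ_imp_Suc)
qed

text \<open>
  Successive iterates merge, so weak sequential continuity of the proximal maps turns a weak cluster
  point into a fixed point of both of them, and the fixed point equations are the saddle point
  inequalities.
\<close>

lemma weak_cluster_point_saddle:
  assumes r: "strict_mono r"
    and lim: "\<And>h. (\<lambda>k. (x (r k), y (r k)) \<bullet> h) \<longlonglongrightarrow> w \<bullet> h"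
  shows "saddle_point Y A g f w"
proof -
  obtain xs ys where w: "w = (xs, ys)" by (cases w)
  have xw: "(\<lambda>k. x (r k) \<bullet> h) \<longlonglongrightarrow> xs \<bullet> h" for h
    using lim[of "(h, 0)"] by (simp add: w)
  have yw: "(\<lambda>k. y (r k) $ i \<bullet> h) \<longlonglongrightarrow> ys $ i \<bullet> h" for i h
    using lim[of "(0, axis i h)"] by (simp add: w inner_axis)
  have ys: "ys $ i \<in> Y i" for i
    by (rule closed_subspace_weakly_closed[OF Y, of "\<lambda>k. y (r k) $ i"])
      (use y_mem yw in \<open>auto simp: prod_space_def\<close>)
  have null: "(\<lambda>k. v (r k) \<bullet> h) \<longlonglongrightarrow> 0" if "v \<longlonglongrightarrow> 0" for v :: "nat \<Rightarrow> 'c::real_inner" and h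
    using tendsto_inner[OF LIMSEQ_subseq_LIMSEQ[OF that r] tendsto_const[of h]] by (simp add: o_def)
  have x_Suc_w: "(\<lambda>k. x (Suc (r k)) \<bullet> h) \<longlonglongrightarrow> xs \<bullet> h" for h
    using tendsto_add[OF null[OF x_diff_tendsto, of h] xw[of h]] by (simp add: inner_diff_left)
  have "weakly_conv_on UNIV (\<lambda>k. x (r k) - \<tau> *\<^sub>R zb (r k)) (xs - \<tau> *\<^sub>R A_adj ys)"
    unfolding weakly_conv_on_def
  proof (intro conjI ballI)
    fix h
    have "(\<lambda>k. x (r k) \<bullet> h - \<tau> * ((zb (r k) - z (r k)) \<bullet> h + (\<Sum>i\<in>UNIV. y (r k) $ i \<bullet> A i h)))
        \<longlonglongrightarrow> xs \<bullet> h - \<tau> * (0 + (\<Sum>i\<in>UNIV. ys $ i \<bullet> A i h))"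
      by (intro tendsto_intros xw null[OF extrapolation_tendsto] tendsto_sum yw)
    moreover have "x (r k) \<bullet> h - \<tau> * ((zb (r k) - z (r k)) \<bullet> h + (\<Sum>i\<in>UNIV. y (r k) $ i \<bullet> A i h))
        = (x (r k) - \<tau> *\<^sub>R zb (r k)) \<bullet> h" for k
      by (simp add: inner_diff_left z_eq A_adj_inner inner_commute[of "A _ _"])
    moreover have "xs \<bullet> h - \<tau> * (0 + (\<Sum>i\<in>UNIV. ys $ i \<bullet> A i h)) = (xs - \<tau> *\<^sub>R A_adj ys) \<bullet> h"
      by (simp add: inner_diff_left A_adj_inner inner_commute[of "A _ _"])
    ultimately show "(\<lambda>k. (x (r k) - \<tau> *\<^sub>R zb (r k)) \<bullet> h) \<longlonglongrightarrow> (xs - \<tau> *\<^sub>R A_adj ys) \<bullet> h"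
      by simp
  qed auto
  then have "weakly_conv_on UNIV (\<lambda>k. x (Suc (r k))) (prox_primal (xs - \<tau> *\<^sub>R A_adj ys))"
    using prox_g unfolding weakly_seq_continuous_on_def x_Suc x_next_def prox_primal_def by blast
  then have "prox_primal (xs - \<tau> *\<^sub>R A_adj ys) \<bullet> h = xs \<bullet> h" for h
    using LIMSEQ_unique[OF _ x_Suc_w[of h]] by (auto simp: weakly_conv_on_def)
  then have fix_x: "prox_primal (xs - \<tau> *\<^sub>R A_adj ys) = xs"
    by (intro iffD1[OF vector_eq_rdot]) blast
  have fix_y: "prox_dual i (ys $ i + \<sigma> i *\<^sub>R A i xs) = ys $ i" for i
  proof -
    let ?q = "prox_dual i (ys $ i + \<sigma> i *\<^sub>R A i xs)"
    have "weakly_conv_on (Y i) (\<lambda>k. y (r k) $ i + \<sigma> i *\<^sub>R A i (x (Suc (r k)))) (ys $ i + \<sigma> i *\<^sub>R A i xs)"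
      unfolding weakly_conv_on_def
    proof (intro conjI ballI allI)
      fix h
      have "(\<lambda>k. y (r k) $ i \<bullet> h + \<sigma> i * (x (Suc (r k)) \<bullet> adjoint (A i) h))
          \<longlonglongrightarrow> ys $ i \<bullet> h + \<sigma> i * (xs \<bullet> adjoint (A i) h)"
        by (intro tendsto_intros yw x_Suc_w)
      then show "(\<lambda>k. (y (r k) $ i + \<sigma> i *\<^sub>R A i (x (Suc (r k)))) \<bullet> h) \<longlonglongrightarrow> (ys $ i + \<sigma> i *\<^sub>R A i xs) \<bullet> h"
        by (simp add: inner_add_left hilbert_adjoint_works[OF A(1)])
    qed (use y_mem ys A(2) Y(1) in \<open>auto simp: prod_space_def intro!: subspace_add subspace_scale\<close>)
    then have "weakly_conv_on (Y i) (\<lambda>k. prox_dual i (y (r k) $ i + \<sigma> i *\<^sub>R A i (x (Suc (r k))))) ?q"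
      using prox_f[of i] unfolding weakly_seq_continuous_on_def prox_dual_def by blast
    moreover have "prox_dual i (y (r k) $ i + \<sigma> i *\<^sub>R A i (x (Suc (r k)))) = y' (r k) $ i" for k
      by (simp add: y'_def y_full_def x_Suc)
    ultimately have q: "?q \<in> Y i" "\<And>h. h \<in> Y i \<Longrightarrow> (\<lambda>k. y' (r k) $ i \<bullet> h) \<longlonglongrightarrow> ?q \<bullet> h"
      by (simp_all add: weakly_conv_on_def)
    have "(\<lambda>k. y' (r k) $ i \<bullet> h) \<longlonglongrightarrow> ys $ i \<bullet> h" for h
      using tendsto_add[OF null[OF y_diff_tendsto[of i], of h] yw[of i h]] by (simp add: inner_diff_left)
    then have "?q \<bullet> h = ys $ i \<bullet> h" if "h \<in> Y i" for h
      using q(2)[OF that] LIMSEQ_unique by blast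
    then have "(?q - ys $ i) \<bullet> (?q - ys $ i) = 0"
      using q(1) ys Y(1) by (subst inner_diff_left) (simp add: subspace_diff)
    then show ?thesis by simp
  qed
  show ?thesis
    unfolding w saddle_point_iff
  proof (intro conjI ballI allI impI)
    show "ys \<in> prod_space Y" using ys by (simp add: prod_space_def)
    show "g xs < \<infinity>" using prox_primal(1) fix_x by metis
    show "fc i (ys $ i) < \<infinity>" for i using prox_dual(2) fix_y by metis
  next
    fix v assume v: "v \<in> prod_space Y" "\<forall>i. fc i (v $ i) < \<infinity>"
    have "A i xs \<bullet> v $ i - F i (v $ i) \<le> A i xs \<bullet> ys $ i - F i (ys $ i)" for i
    proof -
      have "F i (ys $ i) + (1 / \<sigma> i) * ((ys $ i + \<sigma> i *\<^sub>R A i xs - ys $ i) \<bullet> (v $ i - ys $ i)) \<le> F i (v $ i)"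
        using prox_dual(3)[of "v $ i" i "ys $ i + \<sigma> i *\<^sub>R A i xs"] v
        by (simp only: fix_y) (simp add: prod_space_def)
      moreover have "(1 / \<sigma> i) * ((ys $ i + \<sigma> i *\<^sub>R A i xs - ys $ i) \<bullet> d) = A i xs \<bullet> d" for d
        using steps(2)[of i] by simp
      ultimately have "F i (ys $ i) + A i xs \<bullet> (v $ i - ys $ i) \<le> F i (v $ i)" by (simp only:)
      then show ?thesis by (simp add: inner_diff_right)
    qed
    then show "(\<Sum>i\<in>UNIV. A i xs \<bullet> v $ i - F i (v $ i)) \<le> (\<Sum>i\<in>UNIV. A i xs \<bullet> ys $ i - F i (ys $ i))"
      by (rule sum_mono)
  next
    fix u assume "g u < \<infinity>"
    show "A_adj ys \<bullet> xs + G xs \<le> A_adj ys \<bullet> u + G u"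
    proof -
      have "G xs + (1 / \<tau>) * ((xs - \<tau> *\<^sub>R A_adj ys - xs) \<bullet> (u - xs)) \<le> G u"
        using prox_primal(2)[of u "xs - \<tau> *\<^sub>R A_adj ys"] \<open>g u < \<infinity>\<close> by (simp only: fix_x)
      moreover have "(1 / \<tau>) * ((xs - \<tau> *\<^sub>R A_adj ys - xs) \<bullet> d) = - (A_adj ys \<bullet> d)" for d
        using steps(1) by simp
      ultimately have "G xs + - (A_adj ys \<bullet> (u - xs)) \<le> G u" by (simp only:)
      then show ?thesis by (simp add: inner_diff_right)
    qed
  qed
qed

text \<open>The positive operator whose quadratic form is twice \<open>weighted_dist2\<close>.\<close>

definition weight :: "'x \<times> ('b ^ 'n) \<Rightarrow> 'x \<times> ('b ^ 'n)" where
  "weight w = ((1 / \<tau>) *\<^sub>R fst w, \<chi> i. (1 / (\<sigma> i * p i)) *\<^sub>R snd w $ i)"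

lemma bounded_linear_weight: "bounded_linear weight"
proof -
  have "bounded_linear (\<lambda>w :: 'x \<times> ('b ^ 'n). \<chi> i. (1 / (\<sigma> i * p i)) *\<^sub>R snd w $ i)"
    by (rule bounded_linear_vecI)
      (simp add: bounded_linear_const_scaleR bounded_linear_compose[OF bounded_linear_vec_nth bounded_linear_snd])
  then show ?thesis
    unfolding weight_def[abs_def]
    by (intro bounded_linear_Pair bounded_linear_const_scaleR bounded_linear_fst)
qed

lemma weight_symmetric: "v \<bullet> weight w = w \<bullet> weight v"
  by (simp add: weight_def inner_prod_def inner_vec_def inner_commute)

lemma weighted_dist2_eq: "weighted_dist2 v w = 1/2 * ((v - w) \<bullet> weight (v - w))"
proof -
  have "u \<bullet> weight u = (norm (fst u))\<^sup>2 / \<tau> + (\<Sum>i\<in>UNIV. (norm (snd u $ i))\<^sup>2 / (\<sigma> i * p i))" for u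
    by (simp add: weight_def inner_prod_def inner_vec_def power2_norm_eq_inner)
  from this[of "v - w"] show ?thesis
    by (simp add: weighted_dist2_def split_beta sum_distrib_left distrib_left mult.assoc)
qed

lemma weight_definite: "v = 0" if "v \<bullet> weight v = 0"
proof -
  have "(norm (fst v))\<^sup>2 / (2 * \<tau>) + (\<Sum>i\<in>UNIV. (norm (snd v $ i))\<^sup>2 / (2 * \<sigma> i * p i)) = 0"
    using that weighted_dist2_eq[of v 0] by (simp add: weighted_dist2_def split_beta)
  moreover have "0 \<le> (norm (fst v))\<^sup>2 / (2 * \<tau>)" "0 \<le> (\<Sum>i\<in>UNIV. (norm (snd v $ i))\<^sup>2 / (2 * \<sigma> i * p i))"
    using steps(1) weights_pos by (auto intro!: sum_nonneg)
  ultimately have "(norm (fst v))\<^sup>2 / (2 * \<tau>) = 0" "(\<Sum>i\<in>UNIV. (norm (snd v $ i))\<^sup>2 / (2 * \<sigma> i * p i)) = 0"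
    by linarith+
  moreover from this(2) have "(norm (snd v $ i))\<^sup>2 / (2 * \<sigma> i * p i) = 0" for i
    using weights_pos by (subst (asm) sum_nonneg_eq_0_iff) auto
  ultimately show ?thesis
    using steps(1) weights_pos(1,2)[THEN less_imp_neq, THEN not_sym] by (auto simp: prod_eq_iff vec_eq_iff)
qed

lemma iterates_bounded:
  assumes "convergent (\<lambda>k. lyapunov w (state k))"
  shows "\<exists>K. \<forall>k. norm (x k - fst w) \<le> K" "bounded (range (\<lambda>k. (x k, y k)))"
proof -
  obtain K where K: "\<And>k. \<bar>lyapunov w (state k)\<bar> \<le> K"
    using convergent_imp_Bseq[OF assms] by (auto simp: Bseq_def)
  have sum_ge: "0 \<le> (\<Sum>i\<in>UNIV. (norm (y k $ i - snd w $ i))\<^sup>2 / (2 * \<sigma> i * p i))" for k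
    using weights_pos by (intro sum_nonneg) auto
  have le: "(1 - \<gamma>) * ((norm (x k - fst w))\<^sup>2 / (2 * \<tau>))
      + (\<Sum>i\<in>UNIV. (norm (y k $ i - snd w $ i))\<^sup>2 / (2 * \<sigma> i * p i)) \<le> K" for k
    using lyapunov_ge[of "x k" w "y k" "z k" "zb k"] K[of k] unfolding state_eq by linarith
  have xK: "norm (x k - fst w) \<le> sqrt (2 * \<tau> * K / (1 - \<gamma>))" for k
  proof (rule real_le_rsqrt)
    have "(1 - \<gamma>) * ((norm (x k - fst w))\<^sup>2 / (2 * \<tau>)) \<le> K"
      using le[of k] sum_ge[of k] by linarith
    then show "(norm (x k - fst w))\<^sup>2 \<le> 2 * \<tau> * K / (1 - \<gamma>)"
      using gamma(2) steps(1) by (simp add: field_simps)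
  qed
  then show "\<exists>K. \<forall>k. norm (x k - fst w) \<le> K" by blast
  have yK: "norm (y k $ i - snd w $ i) \<le> sqrt (2 * \<sigma> i * p i * K)" for k i
  proof (rule real_le_rsqrt)
    have "0 \<le> (1 - \<gamma>) * ((norm (x k - fst w))\<^sup>2 / (2 * \<tau>))"
      using gamma(2) steps(1) by simp
    moreover have "(norm (y k $ i - snd w $ i))\<^sup>2 / (2 * \<sigma> i * p i)
        \<le> (\<Sum>i\<in>UNIV. (norm (y k $ i - snd w $ i))\<^sup>2 / (2 * \<sigma> i * p i))"
      by (rule member_le_sum) (use weights_pos in auto)
    ultimately have "(norm (y k $ i - snd w $ i))\<^sup>2 / (2 * \<sigma> i * p i) \<le> K"
      using le[of k] by linarith
    then show "(norm (y k $ i - snd w $ i))\<^sup>2 \<le> 2 * \<sigma> i * p i * K"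
      using weights_pos[of i] by (simp add: field_simps)
  qed
  have "norm ((x k, y k) - w) \<le> sqrt (2 * \<tau> * K / (1 - \<gamma>)) + (\<Sum>i\<in>UNIV. sqrt (2 * \<sigma> i * p i * K))" for k
  proof -
    have "norm ((x k, y k) - w) \<le> norm (x k - fst w) + norm (y k - snd w)"
      using norm_Pair_le[of "x k - fst w" "y k - snd w"] by (simp add: minus_prod_def)
    also have "norm (y k - snd w) \<le> (\<Sum>i\<in>UNIV. norm (y k $ i - snd w $ i))"
      using norm_vec_le_sum[of "y k - snd w"] by simp
    also have "\<dots> \<le> (\<Sum>i\<in>UNIV. sqrt (2 * \<sigma> i * p i * K))"
      by (rule sum_mono) (rule yK)
    finally show ?thesis using xK[of k] by linarith
  qed
  then have "(x k, y k) \<in> cball w (sqrt (2 * \<tau> * K / (1 - \<gamma>)) + (\<Sum>i\<in>UNIV. sqrt (2 * \<sigma> i * p i * K)))" for k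
    by (simp add: dist_norm norm_minus_commute)
  then show "bounded (range (\<lambda>k. (x k, y k)))"
    by (intro bounded_subset[OF bounded_cball]) blast
qed

text \<open>The two terms of the Lyapunov function that involve \<open>zb - z\<close> vanish in the limit.\<close>

lemma weighted_dist2_convergent:
  assumes "convergent (\<lambda>k. lyapunov w (state k))"
  shows "convergent (\<lambda>k. weighted_dist2 (x k, y k) w)"
proof -
  obtain K where "\<And>k. norm (x k - fst w) \<le> K"
    using iterates_bounded(1)[OF assms] by blast
  then have 1: "(\<lambda>k. (zb k - z k) \<bullet> (x k - fst w)) \<longlonglongrightarrow> 0"
    by (rule tendsto_inner_null_bounded[OF extrapolation_tendsto])
  have 2: "(\<lambda>k. \<tau> / (2 * \<gamma>) * (norm (zb k - z k))\<^sup>2) \<longlonglongrightarrow> \<tau> / (2 * \<gamma>) * 0\<^sup>2"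
    by (intro tendsto_intros tendsto_norm_zero extrapolation_tendsto)
  have "convergent (\<lambda>k. lyapunov w (state k) + (zb k - z k) \<bullet> (x k - fst w) - \<tau> / (2 * \<gamma>) * (norm (zb k - z k))\<^sup>2)"
    by (rule convergent_diff[OF convergent_add[OF assms convergentI[OF 1]] convergentI[OF 2]])
  then show ?thesis
    unfolding state_eq by (simp add: lyapunov_def)
qed

lemma weakly_convergent_to_saddle:
  assumes C: "\<And>c. c \<in> C \<Longrightarrow> convergent (\<lambda>k. lyapunov c (state k))"
    and dense: "{w. saddle_point Y A g f w} \<subseteq> closure C"
  shows "\<exists>w. saddle_point Y A g f w \<and> (\<forall>h. (\<lambda>k. (x k, y k) \<bullet> h) \<longlonglongrightarrow> w \<bullet> h)"
proof -
  let ?u = "\<lambda>k. (x k, y k)" and ?Z = "{w. saddle_point Y A g f w}"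
  have "C \<noteq> {}" using saddle dense by auto
  then have bdd: "bounded (range ?u)"
    using iterates_bounded(2)[OF C] by blast
  have "convergent (\<lambda>k. ?u k \<bullet> weight (c - c'))" if c: "c \<in> C" "c' \<in> C" for c c'
  proof -
    have "?u k \<bullet> weight (c - c') = weighted_dist2 (?u k) c' - weighted_dist2 (?u k) c
        + (1/2 * (c \<bullet> weight c) - 1/2 * (c' \<bullet> weight c'))" for k
      using weight_symmetric[of c "?u k"] weight_symmetric[of c' "?u k"]
      unfolding weighted_dist2_eq linear_diff[OF bounded_linear.linear[OF bounded_linear_weight]]
      by (simp add: inner_diff_left inner_diff_right field_simps)
    moreover have "convergent (\<lambda>k. weighted_dist2 (?u k) c' - weighted_dist2 (?u k) c
        + (1/2 * (c \<bullet> weight c) - 1/2 * (c' \<bullet> weight c')))"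
      by (intro convergent_add convergent_diff convergent_const weighted_dist2_convergent C c)
    ultimately show ?thesis by presburger
  qed
  then have "\<exists>w\<in>?Z. \<forall>h. (\<lambda>k. ?u k \<bullet> h) \<longlonglongrightarrow> w \<bullet> h"
    using opial_weakly_convergent[OF bdd bounded_linear_weight weight_definite _ dense]
      weak_cluster_point_saddle by blast
  then show ?thesis by blast
qed

end

section \<open>Almost sure convergence\<close>

text \<open>
  The limit is measurable because its inner products with fixed vectors are limits of random
  variables.
\<close>

lemma (in prob_space) weakly_conv_as_toI:
  fixes W :: "nat \<Rightarrow> 'a \<Rightarrow> 'b::{real_inner, second_countable_topology}"
  assumes W: "\<And>k. W k \<in> borel_measurable M"
    and AE: "AE \<omega> in M. \<exists>w. P w \<and> weakly_conv_on H (\<lambda>k. W k \<omega>) w \<and> (\<forall>h. (\<lambda>k. W k \<omega> \<bullet> h) \<longlonglongrightarrow> w \<bullet> h)"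
  shows "weakly_conv_as_to M H W P"
proof -
  let ?lim = "\<lambda>\<omega> w. P w \<and> weakly_conv_on H (\<lambda>k. W k \<omega>) w \<and> (\<forall>h. (\<lambda>k. W k \<omega> \<bullet> h) \<longlonglongrightarrow> w \<bullet> h)"
  obtain N where N: "N \<in> null_sets M" "\<And>\<omega>. \<omega> \<in> space M - N \<Longrightarrow> \<exists>w. ?lim \<omega> w"
    using AE_E3[OF AE] by metis
  then obtain w where w: "\<And>\<omega>. \<omega> \<in> space M - N \<Longrightarrow> ?lim \<omega> (w \<omega>)"
    by metis
  define \<Omega> where "\<Omega> = space M - N"
  define w' where "w' \<omega> = (if \<omega> \<in> \<Omega> then w \<omega> else 0)" for \<omega>
  have \<Omega>: "\<Omega> \<in> sets M"
    using N(1) by (auto simp: \<Omega>_def)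
  have "measure M \<Omega> = 1"
    unfolding \<Omega>_def using N(1) by (subst prob_compl) (auto simp: measure_def null_setsD1)
  moreover have "w' \<in> borel_measurable M"
  proof (rule borel_measurable_if_inner_measurable)
    fix h
    show "(\<lambda>\<omega>. w' \<omega> \<bullet> h) \<in> borel_measurable M"
    proof (rule borel_measurable_LIMSEQ_real)
      show "(\<lambda>\<omega>. indicator \<Omega> \<omega> * (W k \<omega> \<bullet> h)) \<in> borel_measurable M" for k
        using W \<Omega> by (intro borel_measurable_times borel_measurable_inner borel_measurable_const borel_measurable_indicator)
      show "(\<lambda>k. indicator \<Omega> \<omega> * (W k \<omega> \<bullet> h)) \<longlonglongrightarrow> w' \<omega> \<bullet> h" for \<omega>
        using w[of \<omega>] by (cases "\<omega> \<in> \<Omega>") (auto simp: w'_def \<Omega>_def)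
    qed
  qed
  ultimately show ?thesis
    unfolding weakly_conv_as_to_def using w \<Omega>
    by (intro bexI[of _ w'] bexI[of _ \<Omega>]) (auto simp: w'_def \<Omega>_def)
qed

context spdhg_problem
begin

text \<open>
  The exceptional null set of the convergence of \<open>lyapunov c\<close> depends on the saddle point \<open>c\<close>; restricting
  \<open>c\<close> to a countable dense set keeps the union of these sets null.
\<close>

lemma spdhg_converges:
  assumes y0: "y0 \<in> prod_space Y"
  shows "weakly_conv_as_to M (UNIV \<times> prod_space Y)
           (\<lambda>k \<omega>. spdhg_xy Y A g f \<tau> \<sigma> 1 p x0 y0 (\<lambda>j. S j \<omega>) k) (saddle_point Y A g f)"
proof (rule weakly_conv_as_toI)
  let ?X = "path spdhg_step (spdhg_init x0 y0)"
  have xy: "spdhg_xy Y A g f \<tau> \<sigma> 1 p x0 y0 (\<lambda>j. S j \<omega>) k = (fst (?X k \<omega>), fst (snd (?X k \<omega>)))" for k \<omega>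
    by (simp add: spdhg_xy_def spdhg_eq_iterate split_beta)
  show "(\<lambda>\<omega>. spdhg_xy Y A g f \<tau> \<sigma> 1 p x0 y0 (\<lambda>j. S j \<omega>) k) \<in> borel_measurable M" for k
    unfolding xy by (rule borel_measurable_path[of "\<lambda>st. (fst st, fst (snd st))"])
  have init: "spdhg_inv (spdhg_init x0 y0)"
    by (simp add: spdhg_inv_def spdhg_init_def y0)
  obtain C where C: "countable C" "C \<subseteq> {w. saddle_point Y A g f w}" "{w. saddle_point Y A g f w} \<subseteq> closure C"
    using separable[of "{w. saddle_point Y A g f w}"] by metis
  obtain c0 where "saddle_point Y A g f c0" using saddle by blast
  then have "AE \<omega> in M. summable (\<lambda>k. decrease (?X k \<omega>))"
    by (intro lyapunov_summable[of spdhg_inv _ _ "lyapunov c0"] init spdhg_inv_step lyapunov_nonneg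
        decrease_nonneg lyapunov_step)
  moreover have "AE \<omega> in M. \<forall>c\<in>C. convergent (\<lambda>k. lyapunov c (?X k \<omega>))"
  proof (rule AE_ball_countable'[OF _ C(1)])
    fix c assume "c \<in> C"
    then have c: "saddle_point Y A g f c" using C(2) by blast
    show "AE \<omega> in M. convergent (\<lambda>k. lyapunov c (?X k \<omega>))"
    proof (rule lyapunov_convergent[of spdhg_inv])
      show "(\<Sum>t\<in>UNIV. law t * lyapunov c (spdhg_step s t)) \<le> lyapunov c s" if "spdhg_inv s" for s
        using lyapunov_step[OF c that] decrease_nonneg[of s] by linarith
    qed (intro init spdhg_inv_step lyapunov_nonneg; assumption)+
  qed
  ultimately show "AE \<omega> in M. \<exists>w. saddle_point Y A g f w \<and>
      weakly_conv_on (UNIV \<times> prod_space Y) (\<lambda>k. spdhg_xy Y A g f \<tau> \<sigma> 1 p x0 y0 (\<lambda>j. S j \<omega>) k) w \<and>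
      (\<forall>h. (\<lambda>k. spdhg_xy Y A g f \<tau> \<sigma> 1 p x0 y0 (\<lambda>j. S j \<omega>) k \<bullet> h) \<longlonglongrightarrow> w \<bullet> h)"
  proof eventually_elim
    case (elim \<omega>)
    interpret spdhg_path M S Y A g f \<tau> \<sigma> "\<lambda>j. S j \<omega>" x0 y0
      by unfold_locales (use y0 elim in auto)
    have "\<exists>w. saddle_point Y A g f w \<and> (\<forall>h. (\<lambda>k. (x k, y k) \<bullet> h) \<longlonglongrightarrow> w \<bullet> h)"
      by (rule weakly_convergent_to_saddle[OF _ C(3)]) (use elim(2) in blast)
    then obtain w where w: "saddle_point Y A g f w" "\<And>h. (\<lambda>k. (x k, y k) \<bullet> h) \<longlonglongrightarrow> w \<bullet> h"
      by blast
    have "w \<in> UNIV \<times> prod_space Y"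
      using w(1) by (auto simp: saddle_point_def)
    then have "weakly_conv_on (UNIV \<times> prod_space Y) (\<lambda>k. (x k, y k)) w"
      using w(2) y_mem by (auto simp: weakly_conv_on_def)
    then show ?case
      using w unfolding xy x_def y_def by blast
  qed
qed

end

theorem theorem1:
  fixes Y :: "'n::finite \<Rightarrow> 'b::{real_inner, complete_space, second_countable_topology} set"
    and A :: "'n \<Rightarrow> 'x::{real_inner, complete_space, second_countable_topology} \<Rightarrow> 'b"
    and g :: "'x \<Rightarrow> ereal" and f :: "'n \<Rightarrow> 'b \<Rightarrow> ereal"
    and \<tau> \<theta> :: real and \<sigma> :: "'n \<Rightarrow> real"
    and M :: "'w measure" and S :: "nat \<Rightarrow> 'w \<Rightarrow> 'n set"
    and p :: "'n \<Rightarrow> real"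
    and x0 :: 'x and y0 :: "'b ^ 'n"
  assumes Y: "\<And>i. subspace (Y i)" "\<And>i. closed (Y i)"
    and A: "\<And>i. bounded_linear (A i)" "\<And>i x. A i x \<in> Y i"
    and g: "convex_fun_on UNIV g" "proper_fun_on UNIV g" "lsc_fun_on UNIV g"
    and f: "\<And>i. convex_fun_on (Y i) (f i)" "\<And>i. proper_fun_on (Y i) (f i)"
      "\<And>i. lsc_fun_on (Y i) (f i)"
    and steps: "\<tau> > 0" "\<And>i. \<sigma> i > 0"
    and saddle: "\<exists>w. saddle_point Y A g f w"
    and prox_g: "weakly_seq_continuous_on UNIV (prox UNIV (\<lambda>u. ereal \<tau> * g u))"
    and prox_f: "\<And>i. weakly_seq_continuous_on (Y i)
                   (prox (Y i) (\<lambda>u. ereal (\<sigma> i) * conjugate (Y i) (f i) u))"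
    and M: "prob_space M"
    and indep: "prob_space.indep_vars M (\<lambda>_. count_space UNIV) S UNIV"
    and ident: "\<And>k. distr M (count_space UNIV) (S k) = distr M (count_space UNIV) (S 0)"
    and p: "p = inclusion_prob M (S 0)"
    and sampling_proper: "\<And>i. p i > 0"
    and D: "onorm_on (prod_space Y) (step_op M (S 0) A \<tau> \<sigma>) < 1"
    and \<theta>: "\<theta> = 1"
    and y0: "y0 \<in> prod_space Y"
  shows "weakly_conv_as_to M (UNIV \<times> prod_space Y)
           (\<lambda>k \<omega>. spdhg_xy Y A g f \<tau> \<sigma> \<theta> p x0 y0 (\<lambda>j. S j \<omega>) k)
           (saddle_point Y A g f)"
proof -
  have "iid_noise M S"
    by (intro iid_noise.intro iid_noise_axioms.intro M indep ident)
  then interpret spdhg_problem M S Y A g f \<tau> \<sigma>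
    by (intro spdhg_problem.intro spdhg_problem_axioms.intro Y A g f(2) steps saddle prox_g prox_f D
        sampling_proper[unfolded p])
  show ?thesis
    unfolding \<theta> p by (rule spdhg_converges[OF y0])
qed

end
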